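(* Let $n\ge 1$. The $\mathbf{C}$-vector space $$S^3\mathfrak{gl}(n,\mathbf{H})(a)=\big(S^3\mathbf{H}\otimes_{\mathbf{C}}\mathfrak{gl}(n,\mathbf{C})\big)\oplus\Big(\bigoplus_{k=0,1,2}\mathbf{C}a_k\Big)$$ endowed with the ($\mathbf{R}$-bilinear) bracket $$[\phi\otimes X,\psi\otimes Y]^{\widehat{\ }}=(\phi\cdot\psi)\otimes XY-(\psi\cdot\phi)\otimes YX+(X|Y)\sum_{k=0}^2c_k(\phi,\psi)\,a_k,$$ $$[a_k,\phi\otimes X]^{\widehat{\ }}=0,\qquad k=0,1,2,$$ for $\phi,\psi\in S^3\mathbf{H}$ and basis elements $X,Y$ of $\mathfrak{gl}(n,\mathbf{C})$, is a quaternion Lie algebra.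
   Context: Quaternions are written $x=z_1+jz_2$ with $z_1,z_2\in\mathbf{C}$, $zj=j\bar z$; $\mathbf{C}$ acts on $\mathbf{H}$ from the right. $S^3=\{|z|=1\}\subset\mathbf{C}^2$; $S^3\mathbf{H}=C^\infty(S^3,\mathbf{H})$, whose elements are written $u+jv=\begin{pmatrix}u\\ v\end{pmatrix}$; the product is the pointwise quaternion product $\begin{pmatrix}u_1\\ v_1\end{pmatrix}\cdot\begin{pmatrix}u_2\\ v_2\end{pmatrix}=\begin{pmatrix}u_1u_2-\bar v_1v_2\\ v_1u_2+\bar u_1v_2\end{pmatrix}$; $\mathrm{tr}\begin{pmatrix}u\\ v\end{pmatrix}=u+\bar u$; $\sigma\begin{pmatrix}u\\ v\end{pmatrix}=\begin{pmatrix}u\\ -v\end{pmatrix}$. With standard Wirtinger derivatives let $e_+=-z_2\partial_{\bar z_1}+z_1\partial_{\bar z_2}$, $e_-=-\bar z_2\partial_{z_1}+\bar z_1\partial_{z_2}$, $\theta=z_1\partial_{z_1}+z_2\partial_{z_2}-\bar z_1\partial_{\bar z_1}-\bar z_2\partial_{\bar z_2}$, $\theta_0=\sqrt{-1}\theta$, $\theta_1=e_++e_-$, $\theta_2=\sqrt{-1}(e_+-e_-)$ (real vector fields on $S^3$), $\Theta_k\begin{pmatrix}u\\ v\end{pmatrix}=\frac12\begin{pmatrix}\theta_ku\\ \theta_kv\end{pmatrix}$, and $c_k(\phi_1,\phi_2)=\frac1{2\pi^2}\int_{S^3}\mathrm{tr}((\Theta_k\phi_1)\cdot\phi_2)\,d\sigma$,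 with $d\sigma$ the standard volume form of $S^3$. The basis of $\mathfrak{gl}(n,\mathbf{C})$ is $\{E_{ij}\}$, $E_{ij}$ being the $n\times n$ matrix with entry $1$ at place $(i,j)$ and $0$ otherwise; $S^3\mathbf{H}\otimes_{\mathbf{C}}\mathfrak{gl}(n,\mathbf{C})$ is identified with $S^3\mathfrak{gl}(n,\mathbf{H})=\mathrm{Map}(S^3,\mathfrak{gl}(n,\mathbf{H}))$. $(X|Y)=\mathrm{Trace}(XY)$. The $a_k$ are indeterminates, central in the algebra (in particular $[a_j,a_k]^{\widehat{\ }}=0$). The involution is $\sigma(\phi\otimes X)=(\sigma\phi)\otimes X$, $\sigma a_k=a_k$. A quaternion module is a $\mathbf{C}$-module $V$ with a conjugate-linear $J$, $J^2=-I$, so that $V=V_0+JV_0$ for a $\mathbf{C}$-submodule $V_0$; its involution is $\sigma(x+Jy)=x-Jy$, $x,y\in V_0$. A semi-submodule is a $\mathbf{C}$-submodule invariant under $\sigma$. A quaternion Lie algebra is a semi-submodule $\mathfrak{g}$ of a quaternion module with an $\mathbf{R}$-bilinear bracket $\mathfrak{g}\times\mathfrak{g}\to\mathfrak{g}$ that is antisymmetric, satisfies the Jacobi identity, and satisfies $\sigma[X,Y]=[\sigma X,\sigma Y]$ for all $X,Y\in\mathfrak{g}$. *)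

theory Defs
  imports "HOL-Analysis.Analysis" "HOL-Library.Function_Algebras"
begin

section \<open>Quaternion modules and quaternion Lie algebras\<close>

text \<open>The module is the whole type \<^typ>\<open>'v\<close>.  The sum \<open>V = V0 + J V0\<close> is taken to be
  direct, as is needed for the involution \<open>x + J y \<mapsto> x - J y\<close> to be well defined.\<close>

locale quaternion_module = vector_space smul
  for smul :: "complex \<Rightarrow> 'v::ab_group_add \<Rightarrow> 'v" +
  fixes J :: "'v \<Rightarrow> 'v" and V0 :: "'v set"
  assumes J_add: "J (x + y) = J x + J y"
    and J_scale: "J (smul c x) = smul (cnj c) (J x)"
    and J_J: "J (J x) = - x"
    and subspace_V0: "subspace V0"
    and V0_sum: "\<exists>x\<in>V0. \<exists>y\<in>V0. v = x + J y"
    and V0_direct: "V0 \<inter> J ` V0 = {0}"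
begin

definition involution :: "'v \<Rightarrow> 'v" where
  "involution v = (THE w. \<exists>x\<in>V0. \<exists>y\<in>V0. v = x + J y \<and> w = x - J y)"

definition semi_submodule :: "'v set \<Rightarrow> bool" where
  "semi_submodule W \<longleftrightarrow> subspace W \<and> (\<forall>w\<in>W. involution w \<in> W)"

end

definition real_bilinear_on ::
  "(complex \<Rightarrow> 'v::ab_group_add \<Rightarrow> 'v) \<Rightarrow> 'v set \<Rightarrow> ('v \<Rightarrow> 'v \<Rightarrow> 'v) \<Rightarrow> bool" where
  "real_bilinear_on smul W br \<longleftrightarrow>
     (\<forall>x\<in>W. \<forall>y\<in>W. \<forall>z\<in>W. br (x + y) z = br x z + br y z \<and> br z (x + y) = br z x + br z y) \<and>
     (\<forall>r::real. \<forall>x\<in>W. \<forall>y\<in>W. br (smul (complex_of_real r) x) y = smul (complex_of_real r) (br x y) \<and>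
        br x (smul (complex_of_real r) y) = smul (complex_of_real r) (br x y))"

locale quaternion_Lie_algebra = quaternion_module smul J V0
  for smul :: "complex \<Rightarrow> 'v::ab_group_add \<Rightarrow> 'v" and J :: "'v \<Rightarrow> 'v" and V0 :: "'v set" +
  fixes \<gg> :: "'v set" and br :: "'v \<Rightarrow> 'v \<Rightarrow> 'v"
  assumes semi_submod: "semi_submodule \<gg>"
    and br_closed: "x \<in> \<gg> \<Longrightarrow> y \<in> \<gg> \<Longrightarrow> br x y \<in> \<gg>"
    and br_bilinear: "real_bilinear_on smul \<gg> br"
    and br_antisym: "x \<in> \<gg> \<Longrightarrow> y \<in> \<gg> \<Longrightarrow> br x y = - br y x"
    and br_Jacobi: "x \<in> \<gg> \<Longrightarrow> y \<in> \<gg> \<Longrightarrow> z \<in> \<gg> \<Longrightarrow>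
          br x (br y z) + br y (br z x) + br z (br x y) = 0"
    and br_involution: "x \<in> \<gg> \<Longrightarrow> y \<in> \<gg> \<Longrightarrow>
          involution (br x y) = br (involution x) (involution y)"


section \<open>Quaternions\<close>

text \<open>The pair \<open>(u, v)\<close> stands for \<open>u + j v\<close>, where \<open>z j = j (cnj z)\<close>.\<close>

type_synonym quat = "complex \<times> complex"

definition qmul :: "quat \<Rightarrow> quat \<Rightarrow> quat" where
  "qmul p q = (fst p * fst q - cnj (snd p) * snd q, snd p * fst q + cnj (fst p) * snd q)"

text \<open>Right multiplication by a complex number.\<close>
definition qscale :: "complex \<Rightarrow> quat \<Rightarrow> quat" where
  "qscale c q = (fst q * c, snd q * c)"

text \<open>Right multiplication by \<open>j\<close> (left multiplication would be linear for the right
  action of the complex numbers, not conjugate-linear): \<open>(u + j v) j = - cnj v + j (cnj u)\<close>.\<close>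
definition qJ :: "quat \<Rightarrow> quat" where
  "qJ q = (- cnj (snd q), cnj (fst q))"

definition qtr :: "quat \<Rightarrow> complex" where
  "qtr q = fst q + cnj (fst q)"

definition qsigma :: "quat \<Rightarrow> quat" where
  "qsigma q = (fst q, - snd q)"


section \<open>The three-sphere\<close>

typedef S3 = "{z :: complex \<times> complex. norm z = 1}"
proof -
  have "(1, 0) \<in> {z :: complex \<times> complex. norm z = 1}" by (simp add: norm_Pair)
  then show ?thesis by blast
qed

text \<open>\<open>Ck_on k U f\<close>: \<open>f\<close> is of class \<open>C^k\<close> on the open set \<open>U\<close>.\<close>
primrec Ck_on :: "nat \<Rightarrow> 'a::euclidean_space set \<Rightarrow> ('a \<Rightarrow> 'b::real_normed_vector) \<Rightarrow> bool" where
  "Ck_on 0 U f \<longleftrightarrow> continuous_on U f"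
| "Ck_on (Suc k) U f \<longleftrightarrow> (\<forall>x\<in>U. f differentiable (at x)) \<and>
     (\<forall>v. Ck_on k U (\<lambda>x. frechet_derivative f (at x) v))"

text \<open>Smoothness on the embedded submanifold \<open>S^3\<close>: existence of a smooth extension to an
  open neighbourhood.\<close>
definition smooth_S3 :: "(S3 \<Rightarrow> 'b::real_normed_vector) \<Rightarrow> bool" where
  "smooth_S3 f \<longleftrightarrow> (\<exists>U F. open U \<and> range Rep_S3 \<subseteq> U \<and> (\<forall>k. Ck_on k U F) \<and>
     (\<forall>p. F (Rep_S3 p) = f p))"

definition S3H :: "(S3 \<Rightarrow> quat) set" where
  "S3H = {\<phi>. smooth_S3 \<phi>}"

text \<open>Extension of a function on \<open>S^3\<close>, constant along rays (the value at the origin is irrelevant).\<close>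
definition radial_ext :: "(S3 \<Rightarrow> 'b) \<Rightarrow> complex \<times> complex \<Rightarrow> 'b" where
  "radial_ext f z = f (Abs_S3 (z /\<^sub>R norm z))"

text \<open>By polar coordinates \<open>dx = r^3 dr d\<sigma>\<close> on \<open>R^4 = C^2\<close>, the integral over the unit ball
  of the radial extension of \<open>f\<close> is one fourth of the integral of \<open>f\<close> for the standard
  volume form (of total mass \<open>2 \<pi>^2\<close>) of the sphere.\<close>
definition S3_integral :: "(S3 \<Rightarrow> complex) \<Rightarrow> complex" where
  "S3_integral f = 4 * (LINT z:ball 0 1|lborel. radial_ext f z)"


section \<open>Vector fields and the cocycles\<close>

type_synonym C2fun = "complex \<times> complex \<Rightarrow> complex"

definition d_z1 :: "C2fun \<Rightarrow> C2fun" where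
  "d_z1 f z = (frechet_derivative f (at z) (1, 0) - \<i> * frechet_derivative f (at z) (\<i>, 0)) / 2"

definition d_z2 :: "C2fun \<Rightarrow> C2fun" where
  "d_z2 f z = (frechet_derivative f (at z) (0, 1) - \<i> * frechet_derivative f (at z) (0, \<i>)) / 2"

definition d_z1bar :: "C2fun \<Rightarrow> C2fun" where
  "d_z1bar f z = (frechet_derivative f (at z) (1, 0) + \<i> * frechet_derivative f (at z) (\<i>, 0)) / 2"

definition d_z2bar :: "C2fun \<Rightarrow> C2fun" where
  "d_z2bar f z = (frechet_derivative f (at z) (0, 1) + \<i> * frechet_derivative f (at z) (0, \<i>)) / 2"

definition e_plus :: "C2fun \<Rightarrow> C2fun" where
  "e_plus f z = - snd z * d_z1bar f z + fst z * d_z2bar f z"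

definition e_minus :: "C2fun \<Rightarrow> C2fun" where
  "e_minus f z = - cnj (snd z) * d_z1 f z + cnj (fst z) * d_z2 f z"

definition theta :: "C2fun \<Rightarrow> C2fun" where
  "theta f z = fst z * d_z1 f z + snd z * d_z2 f z
     - cnj (fst z) * d_z1bar f z - cnj (snd z) * d_z2bar f z"

text \<open>The index type \<^typ>\<open>3\<close> has exactly the elements \<open>0\<close>, \<open>1\<close>, \<open>2\<close>.\<close>
definition theta_k :: "3 \<Rightarrow> C2fun \<Rightarrow> C2fun" where
  "theta_k k f z = (if k = 0 then \<i> * theta f z
     else if k = 1 then e_plus f z + e_minus f z
     else \<i> * (e_plus f z - e_minus f z))"

text \<open>The fields \<open>\<theta>\<^sub>k\<close> are tangent to \<open>S^3\<close>, so their value on a function on \<open>S^3\<close> does not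
  depend on the extension used; we take the radial one.\<close>
definition theta_S3 :: "3 \<Rightarrow> (S3 \<Rightarrow> complex) \<Rightarrow> S3 \<Rightarrow> complex" where
  "theta_S3 k f p = theta_k k (radial_ext f) (Rep_S3 p)"

definition Theta :: "3 \<Rightarrow> (S3 \<Rightarrow> quat) \<Rightarrow> S3 \<Rightarrow> quat" where
  "Theta k \<phi> p = (theta_S3 k (\<lambda>q. fst (\<phi> q)) p / 2, theta_S3 k (\<lambda>q. snd (\<phi> q)) p / 2)"

definition cocycle :: "3 \<Rightarrow> (S3 \<Rightarrow> quat) \<Rightarrow> (S3 \<Rightarrow> quat) \<Rightarrow> complex" where
  "cocycle k \<phi> \<psi> = 1 / (2 * complex_of_real pi ^ 2) * S3_integral (\<lambda>p. qtr (qmul (Theta k \<phi> p) (\<psi> p)))"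


section \<open>The space \<open>S^3 gl(n,H)(a)\<close>\<close>

text \<open>The ambient quaternion module consists of all maps from \<open>S^3\<close> to \<open>gl(n,H)\<close>, plus
  one copy of \<open>H\<close> for each \<open>a\<^sub>k\<close>.  All operations are componentwise.\<close>

type_synonym 'n ambient = "(S3 \<Rightarrow> quat ^ 'n ^ 'n) \<times> (quat ^ 3)"

definition amb_scale :: "complex \<Rightarrow> 'n::finite ambient \<Rightarrow> 'n ambient" where
  "amb_scale c x = ((\<lambda>p. \<chi> i j. qscale c (fst x p $ i $ j)), (\<chi> k. qscale c (snd x $ k)))"

definition amb_J :: "'n::finite ambient \<Rightarrow> 'n ambient" where
  "amb_J x = ((\<lambda>p. \<chi> i j. qJ (fst x p $ i $ j)), (\<chi> k. qJ (snd x $ k)))"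

definition amb_V0 :: "'n::finite ambient set" where
  "amb_V0 = {x. (\<forall>p i j. snd (fst x p $ i $ j) = 0) \<and> (\<forall>k. snd (snd x $ k) = 0)}"

text \<open>\<open>S^3 H \<otimes> gl(n,C)\<close>, identified with the smooth maps from \<open>S^3\<close> to \<open>gl(n,H)\<close>, plus the
  complex span of the \<open>a\<^sub>k\<close>.\<close>
definition S3gl_a :: "'n::finite ambient set" where
  "S3gl_a = {x. smooth_S3 (fst x) \<and> (\<forall>k. snd (snd x $ k) = 0)}"

text \<open>The element \<open>\<phi> \<otimes> X\<close>, i.e. the map with matrix entries \<open>\<phi> X\<^sub>i\<^sub>j\<close>.\<close>
definition tens :: "(S3 \<Rightarrow> quat) \<Rightarrow> complex ^ 'n ^ 'n \<Rightarrow> 'n::finite ambient" where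
  "tens \<phi> X = ((\<lambda>p. \<chi> i j. qscale (X $ i $ j) (\<phi> p)), 0)"

definition central :: "3 \<Rightarrow> 'n::finite ambient" where
  "central k = (0, axis k (1, 0))"

definition gl_basis :: "(complex ^ 'n ^ 'n) set" where
  "gl_basis = {(\<chi> i j. if i = a \<and> j = b then 1 else 0) | a b. True}"

text \<open>The values on the tensors \<open>\<phi> \<otimes> X\<close>, \<open>X\<close> in the standard basis, determine a real bilinear
  bracket on \<open>S^3 H \<otimes> gl(n,C)\<close>.  The last clause says that the \<open>a\<^sub>k\<close> are central; it also
  covers \<open>[\<phi> \<otimes> X, a\<^sub>k]\<close> and \<open>[a\<^sub>j, a\<^sub>k]\<close>, and is stated for complex multiples of \<open>a\<^sub>k\<close>
  because the bracket is only real bilinear.\<close>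
definition is_S3gl_bracket :: "('n::finite ambient \<Rightarrow> 'n ambient \<Rightarrow> 'n ambient) \<Rightarrow> bool" where
  "is_S3gl_bracket br \<longleftrightarrow>
     real_bilinear_on amb_scale S3gl_a br \<and>
     (\<forall>\<phi>\<in>S3H. \<forall>\<psi>\<in>S3H. \<forall>X\<in>gl_basis. \<forall>Y\<in>gl_basis.
        br (tens \<phi> X) (tens \<psi> Y) =
          tens (\<lambda>p. qmul (\<phi> p) (\<psi> p)) (X ** Y) - tens (\<lambda>p. qmul (\<psi> p) (\<phi> p)) (Y ** X)
          + amb_scale (trace (X ** Y)) (\<Sum>k\<in>UNIV. amb_scale (cocycle k \<phi> \<psi>) (central k))) \<and>
     (\<forall>k c. \<forall>x\<in>S3gl_a. br (amb_scale c (central k)) x = 0 \<and> br x (amb_scale c (central k)) = 0)"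

end

theory Submission
  imports Defs
begin

text \<open>Each \<open>\<theta>\<^sub>k\<close> is a real vector field on the sphere, so \<open>\<Theta>\<^sub>k\<close> is a derivation of the pointwise quaternion
  product; its flow consists of rotations, so the integral of any \<open>\<theta>\<^sub>k f\<close> vanishes.  Together with
  \<open>tr (a b) = tr (b a)\<close> this makes \<open>c\<^sub>k\<close> antisymmetric, and
  \<open>c\<^sub>k (\<phi>, \<psi> \<eta>) + c\<^sub>k (\<psi>, \<eta> \<phi>) + c\<^sub>k (\<eta>, \<phi> \<psi>)\<close> is the integral of a \<open>\<theta>\<^sub>k\<close>-derivative, hence zero.  On
  matrix-valued maps the bracket is \<open>F G - G F\<close> plus the central term
  \<open>\<Sum>\<^sub>i\<^sub>j c\<^sub>k (F\<^sub>i\<^sub>j, G\<^sub>j\<^sub>i) a\<^sub>k\<close>, for which the cyclic identity is the cocycle condition.  Smooth maps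
  are sums of tensors with the matrix units, so the prescribed values determine the bracket.\<close>


section \<open>Smooth functions on the sphere\<close>

lemma Ck_on_cong:
  assumes "open U" "\<And>x. x \<in> U \<Longrightarrow> f x = g x" "Ck_on k U f"
  shows "Ck_on k U g"
  using assms(2,3)
proof (induction k arbitrary: f g)
  case 0
  then show ?case using continuous_on_cong[of U U f g] by simp
next
  case (Suc k)
  \<comment> \<open>As U is open, f and g agree on a whole neighbourhood of x and so share their
    derivative there. This is what lets the later inductions replace a derivative by its formula on
    U.\<close>
  have "g differentiable (at x)" if "x \<in> U" for x
    using Suc.prems that has_derivative_transform_within_open[OF _ \<open>open U\<close>]
    by (simp add: differentiable_def) blast
  moreover have "Ck_on k U (\<lambda>x. frechet_derivative g (at x) v)" for v
  proof (rule Suc.IH)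
    show "Ck_on k U (\<lambda>x. frechet_derivative f (at x) v)" using Suc.prems by simp
    show "frechet_derivative f (at x) v = frechet_derivative g (at x) v" if "x \<in> U" for x
      using Suc.prems that frechet_derivative_transform_within_open[OF _ \<open>open U\<close>, of f x g] by simp
  qed
  ultimately show ?case by simp
qed

lemma Ck_on_subset: "Ck_on k U f \<Longrightarrow> W \<subseteq> U \<Longrightarrow> Ck_on k W f"
  by (induction k arbitrary: f) (auto intro: continuous_on_subset)

text \<open>Serves the Leibniz rule, where a derivative of order k is multiplied by an
  undifferentiated factor that must itself be known to be C^k.\<close>

lemma Ck_on_SucD: "Ck_on (Suc k) U f \<Longrightarrow> Ck_on k U f"
proof (induction k arbitrary: f)
  case 0
  then show ?case
    by (simp add: differentiable_at_imp_differentiable_on differentiable_imp_continuous_on)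
next
  case (Suc k)
  then show ?case by simp
qed

lemma Ck_on_add:
  assumes "open U" "Ck_on k U f" "Ck_on k U g"
  shows "Ck_on k U (\<lambda>x. f x + g x)"
  using assms(2,3)
proof (induction k arbitrary: f g)
  case 0
  then show ?case by (simp add: continuous_on_add)
next
  case (Suc k)
  have "Ck_on k U (\<lambda>x. frechet_derivative (\<lambda>x. f x + g x) (at x) v)" for v
  proof (rule Ck_on_cong[OF \<open>open U\<close>])
    show "Ck_on k U (\<lambda>x. frechet_derivative f (at x) v + frechet_derivative g (at x) v)"
      using Suc by simp
    fix x assume "x \<in> U"
    with Suc.prems have "((\<lambda>x. f x + g x) has_derivative
        (\<lambda>v. frechet_derivative f (at x) v + frechet_derivative g (at x) v)) (at x)"
      by (intro has_derivative_add) (auto simp: frechet_derivative_works[symmetric])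
    from frechet_derivative_at[OF this]
    show "frechet_derivative f (at x) v + frechet_derivative g (at x) v =
        frechet_derivative (\<lambda>x. f x + g x) (at x) v"
      by (rule fun_cong)
  qed
  with Suc.prems show ?case by (auto intro: differentiable_add)
qed

lemma (in bounded_linear) Ck_on:
  assumes "open U" "Ck_on k U g"
  shows "Ck_on k U (\<lambda>x. f (g x))"
  using assms(2)
proof (induction k arbitrary: g)
  case 0
  then show ?case by (simp add: continuous_on)
next
  case (Suc k)
  have D: "((\<lambda>x. f (g x)) has_derivative (\<lambda>v. f (frechet_derivative g (at x) v))) (at x)"
    if "x \<in> U" for x
    using Suc.prems that by (intro has_derivative) (auto simp: frechet_derivative_works[symmetric])
  have "Ck_on k U (\<lambda>x. frechet_derivative (\<lambda>x. f (g x)) (at x) v)" for v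
  proof (rule Ck_on_cong[OF \<open>open U\<close>])
    show "Ck_on k U (\<lambda>x. f (frechet_derivative g (at x) v))"
      using Suc by simp
    show "f (frechet_derivative g (at x) v) = frechet_derivative (\<lambda>x. f (g x)) (at x) v" if "x \<in> U" for x
      using frechet_derivative_at[OF D[OF that]] by (rule fun_cong)
  qed
  with D show ?case by (auto intro: differentiableI)
qed

text \<open>Differentiating a product gives two products with one differentiated factor each; the
  induction is therefore over all pairs of factors at once.\<close>

lemma (in bounded_bilinear) Ck_on:
  assumes "open U" "Ck_on k U f" "Ck_on k U g"
  shows "Ck_on k U (\<lambda>x. prod (f x) (g x))"
  using assms(2,3)
proof (induction k arbitrary: f g)
  case 0
  then show ?case by (simp add: continuous_on)
next
  case (Suc k)
  have D: "((\<lambda>x. prod (f x) (g x)) has_derivative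
      (\<lambda>v. prod (f x) (frechet_derivative g (at x) v) + prod (frechet_derivative f (at x) v) (g x))) (at x)"
    if "x \<in> U" for x
    using Suc.prems that by (intro FDERIV) (auto simp: frechet_derivative_works[symmetric])
  have "Ck_on k U (\<lambda>x. frechet_derivative (\<lambda>x. prod (f x) (g x)) (at x) v)" for v
  proof (rule Ck_on_cong[OF \<open>open U\<close>])
    show "Ck_on k U (\<lambda>x. prod (f x) (frechet_derivative g (at x) v) + prod (frechet_derivative f (at x) v) (g x))"
      using Suc.prems Ck_on_SucD[OF Suc.prems(1)] Ck_on_SucD[OF Suc.prems(2)]
      by (intro Ck_on_add[OF \<open>open U\<close>] Suc.IH) auto
    show "prod (f x) (frechet_derivative g (at x) v) + prod (frechet_derivative f (at x) v) (g x)
       = frechet_derivative (\<lambda>x. prod (f x) (g x)) (at x) v" if "x \<in> U" for x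
      using frechet_derivative_at[OF D[OF that]] by (rule fun_cong)
  qed
  with D show ?case by (auto intro: differentiableI)
qed

section \<open>Linear and bilinear operations on smooth functions on the sphere\<close>

lemma (in bounded_linear) smooth_S3:
  assumes "smooth_S3 g"
  shows "smooth_S3 (\<lambda>p. f (g p))"
proof -
  from assms obtain U G where "open U" "range Rep_S3 \<subseteq> U" "\<forall>k. Ck_on k U G" "\<forall>p. G (Rep_S3 p) = g p"
    unfolding smooth_S3_def by blast
  then show ?thesis unfolding smooth_S3_def
    by (intro exI[of _ U] exI[of _ "\<lambda>z. f (G z)"]) (auto intro: Ck_on)
qed

text \<open>Two smooth functions come with extensions to different neighbourhoods; restricting both
  to the intersection allows them to be combined.\<close>

lemma smooth_S3_pair:
  assumes "smooth_S3 f" "smooth_S3 g"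
  obtains U F G where "open U" "range Rep_S3 \<subseteq> U" "\<And>k. Ck_on k U F" "\<And>p. F (Rep_S3 p) = f p"
    "\<And>k. Ck_on k U G" "\<And>p. G (Rep_S3 p) = g p"
proof -
  from assms obtain U F V G where "open U" "range Rep_S3 \<subseteq> U" "\<forall>k. Ck_on k U F" "\<forall>p. F (Rep_S3 p) = f p"
    "open V" "range Rep_S3 \<subseteq> V" "\<forall>k. Ck_on k V G" "\<forall>p. G (Rep_S3 p) = g p"
    unfolding smooth_S3_def by metis
  then show ?thesis by (intro that[of "U \<inter> V" F G]) (auto intro: Ck_on_subset)
qed

lemma smooth_S3_add:
  assumes "smooth_S3 f" "smooth_S3 g"
  shows "smooth_S3 (\<lambda>p. f p + g p)"
proof (rule smooth_S3_pair[OF assms])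
  fix U F G
  assume "open U" "range Rep_S3 \<subseteq> U" "\<And>k. Ck_on k U F" "\<And>p. F (Rep_S3 p) = f p"
    "\<And>k. Ck_on k U G" "\<And>p. G (Rep_S3 p) = g p"
  then show ?thesis unfolding smooth_S3_def
    by (intro exI[of _ U] exI[of _ "\<lambda>z. F z + G z"]) (auto intro: Ck_on_add)
qed

lemma (in bounded_bilinear) smooth_S3:
  assumes "smooth_S3 f" "smooth_S3 g"
  shows "smooth_S3 (\<lambda>p. prod (f p) (g p))"
proof (rule smooth_S3_pair[OF assms])
  fix U F G
  assume "open U" "range Rep_S3 \<subseteq> U" "\<And>k. Ck_on k U F" "\<And>p. F (Rep_S3 p) = f p"
    "\<And>k. Ck_on k U G" "\<And>p. G (Rep_S3 p) = g p"
  then show ?thesis unfolding smooth_S3_def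
    by (intro exI[of _ U] exI[of _ "\<lambda>z. prod (F z) (G z)"]) (auto intro: Ck_on)
qed

lemma smooth_S3_zero: "smooth_S3 (\<lambda>p. 0)"
proof -
  have "Ck_on k UNIV (\<lambda>x. 0)" for k by (induction k) auto
  then show ?thesis unfolding smooth_S3_def by (intro exI[of _ UNIV]) auto
qed

lemma smooth_S3_sum:
  assumes "finite I" "\<And>i. i \<in> I \<Longrightarrow> smooth_S3 (f i)"
  shows "smooth_S3 (\<lambda>p. \<Sum>i\<in>I. f i p)"
  using assms by (induction I) (auto intro: smooth_S3_zero smooth_S3_add)

lemma smooth_S3_minus: "smooth_S3 f \<Longrightarrow> smooth_S3 (\<lambda>p. - f p)"
  by (rule bounded_linear.smooth_S3[OF bounded_linear_minus[OF bounded_linear_ident]])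

lemma smooth_S3_diff: "smooth_S3 f \<Longrightarrow> smooth_S3 g \<Longrightarrow> smooth_S3 (\<lambda>p. f p - g p)"
  using smooth_S3_add[OF _ smooth_S3_minus] by auto

lemma bounded_linear_axis: "bounded_linear (axis i :: 'a::euclidean_space \<Rightarrow> 'a ^ 'n)"
  by (rule linear_conv_bounded_linear[THEN iffD1]) (auto intro!: linearI simp: axis_def vec_eq_iff)

lemma vec_eq_sum_axis: "(v :: 'a::comm_monoid_add ^ 'n) = (\<Sum>i\<in>UNIV. axis i (v $ i))"
  by (simp add: vec_eq_iff axis_def if_distrib cong: if_cong)

lemma smooth_S3_vec_iff:
  fixes f :: "S3 \<Rightarrow> 'a::euclidean_space ^ 'n"
  shows "smooth_S3 f \<longleftrightarrow> (\<forall>i. smooth_S3 (\<lambda>p. f p $ i))"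
proof (intro iffI allI)
  assume "smooth_S3 f"
  then show "smooth_S3 (\<lambda>p. f p $ i)" for i
    by (rule bounded_linear.smooth_S3[OF bounded_linear_vec_nth])
next
  assume "\<forall>i. smooth_S3 (\<lambda>p. f p $ i)"
  then have "smooth_S3 (\<lambda>p. \<Sum>i\<in>UNIV. axis i (f p $ i))"
    by (intro smooth_S3_sum) (auto intro: bounded_linear.smooth_S3[OF bounded_linear_axis])
  then show "smooth_S3 f" by (simp add: vec_eq_sum_axis[symmetric])
qed

text \<open>Bilinearity is over the reals only, since \<open>qmul\<close> conjugates entries of its
  first factor; boundedness is then automatic in finite dimension.\<close>

lemma bounded_bilinear_qmul: "bounded_bilinear qmul"
  by (rule bilinear_conv_bounded_bilinear[THEN iffD1])
    (auto simp: bilinear_def qmul_def algebra_simps scaleR_conv_of_real intro!: linearI)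

lemma bounded_linear_qscale: "bounded_linear (qscale c)"
  by (rule linear_conv_bounded_linear[THEN iffD1])
    (auto simp: qscale_def algebra_simps scaleR_conv_of_real intro!: linearI)

lemma bounded_linear_qsigma: "bounded_linear qsigma"
  by (rule linear_conv_bounded_linear[THEN iffD1])
    (auto simp: qsigma_def algebra_simps scaleR_conv_of_real intro!: linearI)

lemma bounded_linear_qtr: "bounded_linear qtr"
  by (rule linear_conv_bounded_linear[THEN iffD1])
    (auto simp: qtr_def algebra_simps scaleR_conv_of_real intro!: linearI)


section \<open>Rotations along the vector fields\<close>

lemma distr_shear_fst:
  fixes h :: "'b::euclidean_space \<Rightarrow> 'a::euclidean_space"
  assumes [measurable]: "h \<in> borel_measurable borel"
  shows "distr lborel lborel (\<lambda>z. (fst z + h (snd z), snd z)) = (lborel :: ('a \<times> 'b) measure)"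
proof (rule measure_eqI)
  fix A :: "('a \<times> 'b) set"
  assume "A \<in> sets (distr lborel lborel (\<lambda>z. (fst z + h (snd z), snd z)))"
  then have [measurable]: "A \<in> sets (borel \<Otimes>\<^sub>M borel)" unfolding borel_prod by simp
  then have A: "A \<in> sets lborel" unfolding borel_prod by simp
  have m: "(\<lambda>z. (fst z + h (snd z), snd z)) \<in> measurable lborel (lborel :: ('a \<times> 'b) measure)"
    by (simp add: borel_prod[symmetric])
  have "emeasure (distr lborel lborel (\<lambda>z. (fst z + h (snd z), snd z))) A =
      (\<integral>\<^sup>+ z. indicator A (fst z + h (snd z), snd z) \<partial>(lborel \<Otimes>\<^sub>M lborel))"
    unfolding lborel_prod using A m nn_integral_distr[OF m, of "indicator A"]
    by (subst nn_integral_indicator[symmetric]) simp_all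
  \<comment> \<open>By Tonelli the sheared variable is integrated first. For fixed y the shear is
    the translation by \<open>h y\<close>, under which Lebesgue measure is invariant.\<close>
  also have "\<dots> = (\<integral>\<^sup>+ y. \<integral>\<^sup>+ x. indicator A (h y + x, y) \<partial>lborel \<partial>lborel)"
    by (subst lborel_pair.nn_integral_snd[symmetric]) (auto simp: case_prod_beta add.commute)
  also have "\<dots> = (\<integral>\<^sup>+ y. \<integral>\<^sup>+ x. indicator A (x, y) \<partial>distr lborel borel ((+) (h y)) \<partial>lborel)"
    by (subst nn_integral_distr) auto
  also have "\<dots> = (\<integral>\<^sup>+ z. indicator A z \<partial>(lborel \<Otimes>\<^sub>M lborel))"
    by (subst lborel_pair.nn_integral_snd[symmetric]) (auto simp: case_prod_beta lborel_distr_plus)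
  also have "\<dots> = emeasure lborel A"
    unfolding lborel_prod using A by simp
  finally show "emeasure (distr lborel lborel (\<lambda>z. (fst z + h (snd z), snd z))) A = emeasure lborel A" .
qed simp

lemma distr_shear_snd:
  fixes h :: "'a::euclidean_space \<Rightarrow> 'b::euclidean_space"
  assumes [measurable]: "h \<in> borel_measurable borel"
  shows "distr lborel lborel (\<lambda>z. (fst z, snd z + h (fst z))) = (lborel :: ('a \<times> 'b) measure)"
proof (rule measure_eqI)
  fix A :: "('a \<times> 'b) set"
  assume "A \<in> sets (distr lborel lborel (\<lambda>z. (fst z, snd z + h (fst z))))"
  then have [measurable]: "A \<in> sets (borel \<Otimes>\<^sub>M borel)" unfolding borel_prod by simp
  then have A: "A \<in> sets lborel" unfolding borel_prod by simp
  have m: "(\<lambda>z. (fst z, snd z + h (fst z))) \<in> measurable lborel (lborel :: ('a \<times> 'b) measure)"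
    by (simp add: borel_prod[symmetric])
  have "emeasure (distr lborel lborel (\<lambda>z. (fst z, snd z + h (fst z)))) A =
      (\<integral>\<^sup>+ z. indicator A (fst z, snd z + h (fst z)) \<partial>(lborel \<Otimes>\<^sub>M lborel))"
    unfolding lborel_prod using A m nn_integral_distr[OF m, of "indicator A"]
    by (subst nn_integral_indicator[symmetric]) simp_all
  also have "\<dots> = (\<integral>\<^sup>+ x. \<integral>\<^sup>+ y. indicator A (x, h x + y) \<partial>lborel \<partial>lborel)"
    by (subst lborel.nn_integral_fst[symmetric]) (auto simp: case_prod_beta add.commute)
  also have "\<dots> = (\<integral>\<^sup>+ x. \<integral>\<^sup>+ y. indicator A (x, y) \<partial>distr lborel borel ((+) (h x)) \<partial>lborel)"
    by (subst nn_integral_distr) auto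
  also have "\<dots> = (\<integral>\<^sup>+ z. indicator A z \<partial>(lborel \<Otimes>\<^sub>M lborel))"
    by (subst lborel.nn_integral_fst[symmetric]) (auto simp: case_prod_beta lborel_distr_plus)
  also have "\<dots> = emeasure lborel A"
    unfolding lborel_prod using A by simp
  finally show "emeasure (distr lborel lborel (\<lambda>z. (fst z, snd z + h (fst z)))) A = emeasure lborel A" .
qed simp

definition lborel_preserving :: "('a::euclidean_space \<Rightarrow> 'a) \<Rightarrow> bool" where
  "lborel_preserving T \<longleftrightarrow> T \<in> measurable lborel lborel \<and> distr lborel lborel T = lborel"

lemma lborel_preserving_comp:
  assumes "lborel_preserving S" "lborel_preserving T"
  shows "lborel_preserving (\<lambda>x. S (T x))"
proof -
  have "distr (distr lborel lborel T) lborel S = distr lborel lborel (S \<circ> T)"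
    using assms by (intro distr_distr) (auto simp: lborel_preserving_def)
  with assms show ?thesis
    by (auto simp: lborel_preserving_def comp_def intro: measurable_compose)
qed

lemma lborel_preserving_shear_fst:
  fixes h :: "'b::euclidean_space \<Rightarrow> 'a::euclidean_space"
  assumes "h \<in> borel_measurable borel"
  shows "lborel_preserving (\<lambda>z. (fst z + h (snd z), snd z))"
  using distr_shear_fst[OF assms] assms
  by (simp add: lborel_preserving_def borel_prod[symmetric])

lemma lborel_preserving_shear_snd:
  fixes h :: "'a::euclidean_space \<Rightarrow> 'b::euclidean_space"
  assumes "h \<in> borel_measurable borel"
  shows "lborel_preserving (\<lambda>z. (fst z, snd z + h (fst z)))"
  using distr_shear_snd[OF assms] assms
  by (simp add: lborel_preserving_def borel_prod[symmetric])

text \<open>As for plane rotations, such a map is a product of three shears.\<close>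

lemma lborel_preserving_quaternionic:
  fixes c :: real and w :: complex
  assumes "c\<^sup>2 + (cmod w)\<^sup>2 = 1" "c > -1"
  shows "lborel_preserving (\<lambda>z :: complex \<times> complex. (c *\<^sub>R fst z + w * cnj (snd z), c *\<^sub>R snd z - w * cnj (fst z)))"
proof -
  \<comment> \<open>For a plane rotation by t, with c = cos t and |w| = sin t, this is the
    half-angle tangent sin t / (1 + cos t) of the three-shear decomposition. The condition c > -1
    keeps the denominator nonzero.\<close>
  define a where "a = w / (1 + complex_of_real c)"
  have c: "1 + complex_of_real c \<noteq> 0"
    using assms(2) by (simp add: complex_eq_iff)
  have a: "a * (1 + complex_of_real c) = w" using c by (simp add: a_def)
  have w: "w * cnj w = (1 - of_real c) * (1 + of_real c)"
  proof -
    have "(cmod w)\<^sup>2 = (1 - c) * (1 + c)"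
      using assms(1) by (simp add: algebra_simps power2_eq_square)
    then show ?thesis
      by (simp add: complex_norm_square[symmetric] del: of_real_power)
  qed
  have aw: "w * cnj a = 1 - of_real c" "a * cnj w = 1 - of_real c"
    using w c by (simp_all add: a_def divide_simps mult.commute)
  let ?S = "\<lambda>z :: complex \<times> complex. (fst z + a * cnj (snd z), snd z)"
  let ?T = "\<lambda>z :: complex \<times> complex. (fst z, snd z + - w * cnj (fst z))"
  have S: "lborel_preserving ?S"
    by (rule lborel_preserving_shear_fst) (intro borel_measurable_continuous_onI continuous_intros)
  have T: "lborel_preserving ?T"
    by (rule lborel_preserving_shear_snd) (intro borel_measurable_continuous_onI continuous_intros)
  \<comment> \<open>The first two shears already produce the final second coordinate, because 1 - w
    conj(a) = c; the last shear then corrects the first coordinate.\<close>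
  have "?S (?T (?S z)) = (c *\<^sub>R fst z + w * cnj (snd z), c *\<^sub>R snd z - w * cnj (fst z))" for z
  proof -
    have snd: "snd z + - w * cnj (fst z + a * cnj (snd z)) = c *\<^sub>R snd z - w * cnj (fst z)"
    proof -
      have "snd z + - w * cnj (fst z + a * cnj (snd z)) = snd z - w * cnj (fst z) - (w * cnj a) * snd z"
        by (simp add: algebra_simps)
      then show ?thesis by (simp add: aw scaleR_conv_of_real algebra_simps)
    qed
    have "fst z + a * cnj (snd z) + a * cnj (c *\<^sub>R snd z - w * cnj (fst z))
        = fst z + (a * (1 + of_real c)) * cnj (snd z) - (a * cnj w) * fst z"
      by (simp add: algebra_simps scaleR_conv_of_real)
    also have "\<dots> = c *\<^sub>R fst z + w * cnj (snd z)"
      unfolding a aw by (simp add: scaleR_conv_of_real algebra_simps)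
    finally show ?thesis using snd by simp
  qed
  with lborel_preserving_comp[OF S lborel_preserving_comp[OF T S]] show ?thesis by simp
qed

text \<open>The linear vector field \<open>A\<^sub>k\<close> on \<open>C^2\<close> whose derivation is \<open>\<theta>\<^sub>k\<close>.  Since \<open>A\<^sub>k\<^sup>2 = -1\<close>,
  its flow is \<open>cos t + A\<^sub>k sin t\<close>.\<close>

definition vfield :: "3 \<Rightarrow> complex \<times> complex \<Rightarrow> complex \<times> complex" where
  "vfield k z = (if k = 0 then (\<i> * fst z, \<i> * snd z)
     else if k = 1 then (- cnj (snd z), cnj (fst z))
     else (\<i> * cnj (snd z), - \<i> * cnj (fst z)))"

text \<open>Both sides are combinations of the derivatives along the four real coordinate directions
  of C^2. The imaginary parts of the Wirtinger coefficients cancel, which is the statement that the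
  fields are real.\<close>

lemma theta_k_eq_frechet:
  assumes "f differentiable (at z)"
  shows "theta_k k f z = frechet_derivative f (at z) (vfield k z)"
proof -
  let ?L = "frechet_derivative f (at z)"
  interpret linear ?L by (rule linear_frechet_derivative[OF assms])
  define a b c d where "a = ?L (1, 0)" "b = ?L (\<i>, 0)" "c = ?L (0, 1)" "d = ?L (0, \<i>)"
  have L: "?L (x, y) = Re x *\<^sub>R a + Im x *\<^sub>R b + Re y *\<^sub>R c + Im y *\<^sub>R d" for x y
  proof -
    have "(x, y) = Re x *\<^sub>R (1, 0) + Im x *\<^sub>R (\<i>, 0) + Re y *\<^sub>R (0, 1) + Im y *\<^sub>R (0, \<i>)"
      by (simp add: complex_eq_iff)
    then show ?thesis unfolding a_b_c_d_def by (metis add scale)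
  qed
  show ?thesis
    by (auto simp: theta_k_def vfield_def e_plus_def e_minus_def theta_def d_z1_def d_z2_def
        d_z1bar_def d_z2bar_def L a_b_c_d_def(1)[symmetric] a_b_c_d_def(2)[symmetric]
        a_b_c_d_def(3)[symmetric] a_b_c_d_def(4)[symmetric] complex_eq_iff field_simps)
qed

section \<open>Flows of the three vector fields\<close>

lemma linear_vfield: "linear (vfield k)"
  by (rule linearI) (auto simp: vfield_def algebra_simps scaleR_conv_of_real)

lemma vfield_vfield: "vfield k (vfield k z) = - z"
  by (cases z) (auto simp: vfield_def)

lemma inner_vfield: "z \<bullet> vfield k z = 0"
  by (cases z) (auto simp: vfield_def inner_complex_def)

lemma norm_vfield: "norm (vfield k z) = norm z"
  by (cases z) (auto simp: vfield_def norm_Pair norm_mult add.commute)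

definition vflow :: "3 \<Rightarrow> real \<Rightarrow> complex \<times> complex \<Rightarrow> complex \<times> complex" where
  "vflow k t z = cos t *\<^sub>R z + sin t *\<^sub>R vfield k z"

text \<open>Pythagoras: z and \<open>vfield k z\<close> are orthogonal and of equal length.\<close>

lemma norm_vflow: "norm (vflow k t z) = norm z"
proof -
  have "norm (vflow k t z) ^ 2 = (cos t)\<^sup>2 * norm z ^ 2 + (sin t)\<^sup>2 * norm (vfield k z) ^ 2"
    unfolding vflow_def power2_norm_eq_inner
    by (simp add: inner_add_left inner_add_right inner_vfield inner_commute[of "vfield k z" z] power2_eq_square)
  also have "\<dots> = ((cos t)\<^sup>2 + (sin t)\<^sup>2) * norm z ^ 2"
    by (simp only: norm_vfield distrib_right)
  also have "(cos t)\<^sup>2 + (sin t)\<^sup>2 = 1" by simp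
  finally show ?thesis by simp
qed

lemma vflow_0 [simp]: "vflow k 0 z = z"
  by (simp add: vflow_def)

lemma vflow_has_vector_derivative:
  "((\<lambda>t. vflow k t z) has_vector_derivative vfield k (vflow k t z)) (at t within S)"
proof -
  have "vfield k (vflow k t z) = cos t *\<^sub>R vfield k z - sin t *\<^sub>R z"
    unfolding vflow_def
    by (simp add: linear_add[OF linear_vfield] linear_scale[OF linear_vfield] vfield_vfield)
  moreover have "((\<lambda>t. vflow k t z) has_vector_derivative cos t *\<^sub>R vfield k z - sin t *\<^sub>R z) (at t within S)"
    unfolding vflow_def has_vector_derivative_def
    by (auto intro!: derivative_eq_intros simp: fun_eq_iff algebra_simps)
  ultimately show ?thesis by simp
qed

text \<open>For k = 1 and k = 2 the flow is itself a map of the quaternionic form with c = cos t,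
  where w = -sin t and w = i sin t respectively.\<close>

lemma lborel_preserving_vflow:
  assumes "cos t > -1"
  shows "lborel_preserving (vflow k t)"
proof -
  consider "k = 0" | "k = 1" | "k = 2" using exhaust_3 by fastforce
  then show ?thesis
  proof cases
    case 1
    \<comment> \<open>multiplication by \<open>cis t\<close> is a product of two maps of the quaternionic form\<close>
    have "lborel_preserving (\<lambda>z :: complex \<times> complex. (0 *\<^sub>R fst z + w * cnj (snd z), 0 *\<^sub>R snd z - w * cnj (fst z)))"
      if "cmod w = 1" for w
      using that by (intro lborel_preserving_quaternionic) auto
    from lborel_preserving_comp[OF this[of "cis t"] this[of "-1"]]
    have "lborel_preserving (\<lambda>z. (cis t * fst z, cis t * snd z))" by simp
    also have "(\<lambda>z. (cis t * fst z, cis t * snd z)) = vflow k t"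
      unfolding 1 by (auto simp: vflow_def vfield_def fun_eq_iff complex_eq_iff)
    finally show ?thesis .
  next
    case 2
    have "lborel_preserving (\<lambda>z :: complex \<times> complex. (cos t *\<^sub>R fst z + (- of_real (sin t)) * cnj (snd z), cos t *\<^sub>R snd z - (- of_real (sin t)) * cnj (fst z)))"
      using assms by (intro lborel_preserving_quaternionic) auto
    also have "(\<lambda>z. (cos t *\<^sub>R fst z + (- of_real (sin t)) * cnj (snd z), cos t *\<^sub>R snd z - (- of_real (sin t)) * cnj (fst z))) = vflow k t"
      unfolding 2 by (auto simp: vflow_def vfield_def fun_eq_iff complex_eq_iff)
    finally show ?thesis .
  next
    case 3
    have "lborel_preserving (\<lambda>z :: complex \<times> complex. (cos t *\<^sub>R fst z + (\<i> * of_real (sin t)) * cnj (snd z), cos t *\<^sub>R snd z - (\<i> * of_real (sin t)) * cnj (fst z)))"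
      using assms by (intro lborel_preserving_quaternionic) (auto simp: norm_mult)
    also have "(\<lambda>z. (cos t *\<^sub>R fst z + (\<i> * of_real (sin t)) * cnj (snd z), cos t *\<^sub>R snd z - (\<i> * of_real (sin t)) * cnj (fst z))) = vflow k t"
      unfolding 3 by (auto simp: vflow_def vfield_def fun_eq_iff complex_eq_iff)
    finally show ?thesis .
  qed
qed

lemma integral_lborel_preserving:
  fixes f :: "'a::euclidean_space \<Rightarrow> 'b::{banach, second_countable_topology}"
  assumes "lborel_preserving T" "f \<in> borel_measurable borel"
  shows "(\<integral>x. f (T x) \<partial>lborel) = (\<integral>x. f x \<partial>lborel)"
  using assms integral_distr[of T lborel lborel f] by (simp add: lborel_preserving_def)


section \<open>Derivatives and integrals on the sphere\<close>

lemma norm_Rep_S3 [simp]: "norm (Rep_S3 p) = 1"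
  using Rep_S3[of p] by simp

lemma Rep_S3_neq_0 [simp]: "Rep_S3 p \<noteq> 0"
  using norm_Rep_S3[of p] by force

lemma Rep_Abs_S3: "norm z = 1 \<Longrightarrow> Rep_S3 (Abs_S3 z) = z"
  by (simp add: Abs_S3_inverse)

lemma Rep_Abs_S3_normalize: "z \<noteq> 0 \<Longrightarrow> Rep_S3 (Abs_S3 (z /\<^sub>R norm z)) = z /\<^sub>R norm z"
  by (rule Rep_Abs_S3) simp

lemma radial_ext_Rep [simp]: "radial_ext f (Rep_S3 p) = f p"
  by (simp add: radial_ext_def Rep_S3_inverse)

lemma smooth_S3_C1_extension:
  assumes "smooth_S3 f"
  shows "\<exists>U G. open U \<and> range Rep_S3 \<subseteq> U \<and> (\<forall>z\<in>U. G differentiable (at z)) \<and>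
    (\<forall>v. continuous_on U (\<lambda>z. frechet_derivative G (at z) v)) \<and> (\<forall>p. G (Rep_S3 p) = f p)"
proof -
  from assms obtain U G where "open U" "range Rep_S3 \<subseteq> U" "\<forall>k. Ck_on k U G" "\<forall>p. G (Rep_S3 p) = f p"
    unfolding smooth_S3_def by blast
  moreover have "(\<forall>x\<in>U. G differentiable (at x)) \<and> (\<forall>v. continuous_on U (\<lambda>z. frechet_derivative G (at z) v))"
    using spec[OF \<open>\<forall>k. Ck_on k U G\<close>, of "Suc 0"] by simp
  ultimately show ?thesis by blast
qed

text \<open>Off the origin the radial extension is any smooth local extension composed with the
  normalization x / |x|, and the chain rule applies.\<close>

lemma radial_ext_differentiable:
  assumes "smooth_S3 f" "z \<noteq> 0"
  shows "radial_ext f differentiable (at z)"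
proof -
  obtain U G where U: "open U" "range Rep_S3 \<subseteq> U"
    and G: "\<forall>z\<in>U. G differentiable (at z)" and Gf: "\<forall>p. G (Rep_S3 p) = f p"
    using smooth_S3_C1_extension[OF assms(1)] by blast
  have eq: "G (x /\<^sub>R norm x) = radial_ext f x" if "x \<in> - {0}" for x
    using that spec[OF Gf, of "Abs_S3 (x /\<^sub>R norm x)"] by (simp add: radial_ext_def Rep_Abs_S3_normalize)
  have "z /\<^sub>R norm z \<in> U"
    using U(2) Rep_Abs_S3_normalize[OF assms(2)] by (metis rangeI subsetD)
  then have "G differentiable (at (z /\<^sub>R norm z))" using G by blast
  moreover have "(\<lambda>x. x /\<^sub>R norm x) differentiable (at z)"
    using assms(2) by (intro differentiable_scaleR differentiable_inverse differentiable_norm_at differentiable_ident) auto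
  ultimately have "G \<circ> (\<lambda>x. x /\<^sub>R norm x) differentiable (at z)"
    by (intro differentiable_chain_at)
  then obtain D where "(G \<circ> (\<lambda>x. x /\<^sub>R norm x) has_derivative D) (at z)"
    unfolding differentiable_def by blast
  then have "(radial_ext f has_derivative D) (at z)"
    by (rule has_derivative_transform_within_open[of _ _ _ _ "- {0}"]) (use assms(2) eq in auto)
  then show ?thesis by (rule differentiableI)
qed

text \<open>Generalizes \<open>theta_S3 k\<close> to vector-valued functions, so that linear maps
  and product rules for quaternions can be handled without splitting into components.\<close>

definition vderiv :: "3 \<Rightarrow> (S3 \<Rightarrow> 'b::real_normed_vector) \<Rightarrow> S3 \<Rightarrow> 'b" where
  "vderiv k f p = frechet_derivative (radial_ext f) (at (Rep_S3 p)) (vfield k (Rep_S3 p))"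

lemma radial_ext_has_derivative:
  assumes "smooth_S3 f"
  shows "(radial_ext f has_derivative frechet_derivative (radial_ext f) (at (Rep_S3 p))) (at (Rep_S3 p))"
  using radial_ext_differentiable[OF assms] by (simp add: frechet_derivative_works[symmetric])

lemma theta_S3_eq_vderiv: "smooth_S3 f \<Longrightarrow> theta_S3 k f p = vderiv k f p"
  by (simp add: theta_S3_def vderiv_def theta_k_eq_frechet radial_ext_differentiable)

lemma vderiv_eqI:
  assumes "(radial_ext f has_derivative D) (at (Rep_S3 p))"
  shows "vderiv k f p = D (vfield k (Rep_S3 p))"
  using frechet_derivative_at[OF assms] by (simp add: vderiv_def)

text \<open>Radial extension is evaluation at a projected point, so it commutes with every pointwise
  operation. This and the next two rules are thus the rules of calculus on C^2, read off at points
  of the sphere.\<close>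

lemma vderiv_add:
  assumes "smooth_S3 f" "smooth_S3 g"
  shows "vderiv k (\<lambda>p. f p + g p) p = vderiv k f p + vderiv k g p"
  unfolding vderiv_def[of k f] vderiv_def[of k g]
  by (rule vderiv_eqI) (use has_derivative_add[OF assms[THEN radial_ext_has_derivative]] in
      \<open>simp add: radial_ext_def[abs_def]\<close>)

lemma (in bounded_linear) vderiv:
  assumes "smooth_S3 g"
  shows "vderiv k (\<lambda>p. f (g p)) p = f (vderiv k g p)"
  unfolding vderiv_def[of k g]
  by (rule vderiv_eqI) (use has_derivative[OF radial_ext_has_derivative[OF assms]] in
      \<open>simp add: radial_ext_def[abs_def]\<close>)

lemma (in bounded_bilinear) vderiv:
  assumes "smooth_S3 f" "smooth_S3 g"
  shows "vderiv k (\<lambda>p. prod (f p) (g p)) p = prod (f p) (vderiv k g p) + prod (vderiv k f p) (g p)"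
proof -
  have "((\<lambda>x. prod (radial_ext f x) (radial_ext g x)) has_derivative
      (\<lambda>h. prod (f p) (frechet_derivative (radial_ext g) (at (Rep_S3 p)) h) +
        prod (frechet_derivative (radial_ext f) (at (Rep_S3 p)) h) (g p))) (at (Rep_S3 p))"
    using FDERIV[OF assms[THEN radial_ext_has_derivative]] by simp
  then show ?thesis
    unfolding vderiv_def[of k f] vderiv_def[of k g]
    by (intro vderiv_eqI) (simp add: radial_ext_def[abs_def])
qed

lemma Theta_eq_vderiv:
  assumes "smooth_S3 \<phi>"
  shows "Theta k \<phi> p = vderiv k \<phi> p /\<^sub>R 2"
proof -
  have "smooth_S3 (\<lambda>q. fst (\<phi> q))" "smooth_S3 (\<lambda>q. snd (\<phi> q))"
    using bounded_linear.smooth_S3[OF bounded_linear_fst assms] bounded_linear.smooth_S3[OF bounded_linear_snd assms] .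
  then show ?thesis
    using bounded_linear.vderiv[OF bounded_linear_fst assms] bounded_linear.vderiv[OF bounded_linear_snd assms]
    by (simp add: Theta_def theta_S3_eq_vderiv prod_eq_iff scaleR_conv_of_real)
qed

text \<open>Compares the two extensions along an orbit of the flow, which stays on the sphere; this avoids
  the derivative of the normalization map.\<close>

lemma vderiv_extension:
  assumes "smooth_S3 f" "G differentiable (at (Rep_S3 p))" "\<And>p. G (Rep_S3 p) = f p"
  shows "vderiv k f p = frechet_derivative G (at (Rep_S3 p)) (vfield k (Rep_S3 p))"
proof -
  let ?c = "\<lambda>t. vflow k t (Rep_S3 p)"
  have c: "(?c has_vector_derivative vfield k (Rep_S3 p)) (at 0)"
    using vflow_has_vector_derivative[of k "Rep_S3 p" 0 UNIV] by simp
  have "(radial_ext f \<circ> ?c has_vector_derivative vderiv k f p) (at 0)"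
    unfolding vderiv_def by (rule vector_derivative_diff_chain_within[OF c])
      (use radial_ext_has_derivative[OF assms(1)] in \<open>auto intro: has_derivative_at_withinI\<close>)
  moreover have "(G \<circ> ?c has_vector_derivative frechet_derivative G (at (Rep_S3 p)) (vfield k (Rep_S3 p))) (at 0)"
    by (rule vector_derivative_diff_chain_within[OF c])
      (use assms(2) in \<open>auto simp: frechet_derivative_works intro: has_derivative_at_withinI\<close>)
  moreover have "radial_ext f \<circ> ?c = G \<circ> ?c"
  proof
    fix t
    have "norm (?c t) = 1" by (simp add: norm_vflow)
    then obtain q where "?c t = Rep_S3 q" using Rep_Abs_S3 by metis
    then show "(radial_ext f \<circ> ?c) t = (G \<circ> ?c) t" by (simp add: assms(3))
  qed
  ultimately show ?thesis by (metis vector_derivative_unique_at)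
qed

text \<open>The radial extension is homogeneous of degree 0 and \<open>vfield k\<close> of degree 1,
  so differentiating along the field commutes with passing to the radial extension.\<close>

lemma radial_ext_vderiv:
  assumes "smooth_S3 f" "z \<noteq> 0"
  shows "radial_ext (vderiv k f) z = frechet_derivative (radial_ext f) (at z) (vfield k z)"
proof -
  let ?F = "radial_ext f" and ?p = "Abs_S3 (z /\<^sub>R norm z)"
  have p: "Rep_S3 ?p = z /\<^sub>R norm z" using assms(2) by (rule Rep_Abs_S3_normalize)
  \<comment> \<open>The divisor is the fixed number |z|, not |x|: this is a linear dilation and
    hence its own derivative.\<close>
  have "((\<lambda>x. x /\<^sub>R norm z) has_derivative (\<lambda>x. x /\<^sub>R norm z)) (at z)"
    by (auto intro!: derivative_eq_intros)
  from has_derivative_compose[OF this] radial_ext_has_derivative[OF assms(1), of ?p]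
  have D: "((\<lambda>x. ?F (x /\<^sub>R norm z)) has_derivative
      (\<lambda>x. frechet_derivative ?F (at (Rep_S3 ?p)) (x /\<^sub>R norm z))) (at z)"
    unfolding p by blast
  have "?F (x /\<^sub>R norm z) = ?F x" for x
  proof -
    have "(x /\<^sub>R norm z) /\<^sub>R norm (x /\<^sub>R norm z) = x /\<^sub>R norm x"
      using assms(2) by (cases "x = 0") (simp_all add: field_simps)
    then show ?thesis by (simp only: radial_ext_def)
  qed
  with D have "frechet_derivative ?F (at z) = (\<lambda>x. frechet_derivative ?F (at (Rep_S3 ?p)) (x /\<^sub>R norm z))"
    using frechet_derivative_at by (metis (no_types, lifting) ext)
  then show ?thesis
    using p linear_scale[OF linear_vfield, of k "inverse (norm z)" z]
    by (simp add: radial_ext_def[of "vderiv k f"] vderiv_def)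
qed

text \<open>The type \<open>S3\<close> carries no topology of its own here; continuity is
  transported to the unit sphere of C^2.\<close>

definition cont_S3 :: "(S3 \<Rightarrow> 'b::real_normed_vector) \<Rightarrow> bool" where
  "cont_S3 f \<longleftrightarrow> continuous_on (sphere 0 1) (\<lambda>z. f (Abs_S3 z))"

lemma cont_S3_smooth:
  assumes "smooth_S3 f"
  shows "cont_S3 f"
  unfolding cont_S3_def
proof (rule continuous_on_eq)
  have "continuous (at z) (radial_ext f)" if "z \<in> sphere 0 1" for z
    using that by (intro differentiable_imp_continuous_within radial_ext_differentiable assms) auto
  then show "continuous_on (sphere 0 1) (radial_ext f)"
    by (simp add: continuous_at_imp_continuous_on)
qed (simp add: radial_ext_def)

text \<open>The class C^1 gives continuity of the derivative of G in each fixed direction only,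
  whereas \<open>vfield k z\<close> moves with z. Expanding the field in the standard basis reduces
  to fixed directions.\<close>

lemma cont_S3_vderiv:
  assumes "smooth_S3 f"
  shows "cont_S3 (vderiv k f)"
proof -
  obtain U G where U: "open U" "range Rep_S3 \<subseteq> U"
    and G: "\<forall>z\<in>U. G differentiable (at z)"
    and cont: "\<forall>v. continuous_on U (\<lambda>z. frechet_derivative G (at z) v)" and Gf: "\<forall>p. G (Rep_S3 p) = f p"
    using smooth_S3_C1_extension[OF assms] by blast
  have sub: "sphere 0 1 \<subseteq> U" using U(2) Rep_Abs_S3 by (metis mem_sphere_0 rangeI subset_iff)
  show ?thesis unfolding cont_S3_def
  proof (rule continuous_on_eq)
    show "continuous_on (sphere 0 1) (\<lambda>z. \<Sum>b\<in>Basis. (vfield k z \<bullet> b) *\<^sub>R frechet_derivative G (at z) b)"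
      by (intro continuous_intros continuous_on_subset[OF cont[rule_format] sub] linear_continuous_on
          linear_conv_bounded_linear[THEN iffD1, OF linear_vfield])
    fix z :: "complex \<times> complex" assume z: "z \<in> sphere 0 1"
    then have G': "G differentiable (at z)" using sub G by blast
    have "vderiv k f (Abs_S3 z) = frechet_derivative G (at z) (vfield k z)"
      using z vderiv_extension[OF assms _ Gf[rule_format], of "Abs_S3 z" k] G' by (simp add: Rep_Abs_S3)
    also have "\<dots> = frechet_derivative G (at z) (\<Sum>b\<in>Basis. (vfield k z \<bullet> b) *\<^sub>R b)"
      by (simp only: euclidean_representation)
    also have "\<dots> = (\<Sum>b\<in>Basis. (vfield k z \<bullet> b) *\<^sub>R frechet_derivative G (at z) b)"
      using linear_frechet_derivative[OF G'] by (simp only: linear_sum linear_scale)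
    finally show "(\<Sum>b\<in>Basis. (vfield k z \<bullet> b) *\<^sub>R frechet_derivative G (at z) b) = vderiv k f (Abs_S3 z)" ..
  qed
qed

section \<open>Boundedness, measurability and integrability of radial extensions\<close>

lemma cont_S3_bounded:
  assumes "cont_S3 f"
  obtains M where "\<And>z. z \<noteq> 0 \<Longrightarrow> norm (radial_ext f z) \<le> M"
proof -
  have "bounded ((\<lambda>z. f (Abs_S3 z)) ` sphere 0 1)"
    using assms by (intro compact_imp_bounded compact_continuous_image) (auto simp: cont_S3_def)
  then obtain M where "\<forall>x\<in>(\<lambda>z. f (Abs_S3 z)) ` sphere 0 1. norm x \<le> M"
    unfolding bounded_iff by blast
  then show ?thesis by (intro that[of M]) (auto simp: radial_ext_def)
qed

text \<open>The radial extension is continuous off the origin, and changing a function at one point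
  preserves Borel measurability.\<close>

lemma cont_S3_measurable:
  fixes f :: "S3 \<Rightarrow> 'b::{real_normed_vector, second_countable_topology}"
  assumes "cont_S3 f"
  shows "radial_ext f \<in> borel_measurable borel"
proof -
  have "continuous_on (- {0}) (\<lambda>z. f (Abs_S3 (z /\<^sub>R norm z)))"
    by (rule continuous_on_compose2[OF assms[unfolded cont_S3_def]])
      (intro continuous_intros, simp, simp add: image_subset_iff)
  then have "continuous_on (- {0}) (radial_ext f)" by (simp add: radial_ext_def[abs_def])
  then have "(\<lambda>z. indicat_real (- {0}) z *\<^sub>R radial_ext f z) \<in> borel_measurable borel"
    by (intro borel_measurable_continuous_on_indicator) auto
  then show ?thesis
    by (rule measurable_discrete_difference[where X = "{0}"]) auto
qed

lemma cont_S3_integrable: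
  fixes f :: "S3 \<Rightarrow> 'b::{banach, second_countable_topology}"
  assumes "cont_S3 f"
  shows "set_integrable lborel (ball 0 1) (radial_ext f)"
proof -
  obtain M where M: "\<And>z. z \<noteq> 0 \<Longrightarrow> norm (radial_ext f z) \<le> M"
    using cont_S3_bounded[OF assms] by blast
  show ?thesis
    unfolding set_integrable_def
  proof (rule integrableI_bounded_set_indicator[where B = M])
    show "AE x in lborel. x \<in> ball 0 1 \<longrightarrow> norm (radial_ext f x) \<le> M"
      using AE_lborel_singleton[of 0] by eventually_elim (use M in auto)
  qed (use cont_S3_measurable[OF assms] emeasure_lborel_ball_finite[of "0 :: complex \<times> complex" 1] in auto)
qed

lemma S3_integral_add:
  assumes "cont_S3 f" "cont_S3 g"
  shows "S3_integral (\<lambda>p. f p + g p) = S3_integral f + S3_integral g"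
  using set_integral_add(2)[OF assms[THEN cont_S3_integrable]]
  by (simp add: S3_integral_def radial_ext_def[abs_def] distrib_left)

text \<open>Holds for arbitrary f because the integral of a nonintegrable function is 0 by
  convention.\<close>

lemma S3_integral_mult: "S3_integral (\<lambda>p. c * f p) = c * S3_integral f"
  by (simp add: S3_integral_def radial_ext_def[abs_def])

text \<open>The flow preserves the unit ball and Lebesgue measure, so the difference quotients along it
  have integral zero; they are dominated by the maximum of the derivative.\<close>

lemma S3_integral_vderiv:
  assumes "smooth_S3 f"
  shows "S3_integral (vderiv k f) = 0"
proof -
  let ?F = "radial_ext f" and ?g = "radial_ext (vderiv k f)" and ?B = "ball 0 1 :: (complex \<times> complex) set"
  have F: "cont_S3 f" and g: "cont_S3 (vderiv k f)"
    using assms cont_S3_smooth cont_S3_vderiv by blast+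
  obtain M where M: "\<And>z. z \<noteq> 0 \<Longrightarrow> norm (?g z) \<le> M"
    using cont_S3_bounded[OF g] by blast
  have M0: "0 \<le> M" using order_trans[OF norm_ge_zero M[of "(1, 0)"]] by (simp add: zero_prod_def)
  \<comment> \<open>Step sizes tending to 0 within (0, 1]. There cos is nonnegative, so the
    condition cos t > -1 for measure preservation holds.\<close>
  define h where "h n = inverse (real (Suc n))" for n
  have h: "0 < h n" "h n \<le> 1" for n by (auto simp: h_def field_simps)
  have hcos: "cos (h n) > -1" for n
    using cos_ge_zero[of "h n"] h[of n] pi_ge_two by linarith
  have h0: "h \<longlonglongrightarrow> 0" unfolding h_def by (rule LIMSEQ_inverse_real_of_nat)
  define d where "d n z = (?F (vflow k (h n) z) - ?F z) /\<^sub>R h n" for n z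
  have deriv: "((\<lambda>t. ?F (vflow k t z)) has_vector_derivative ?g (vflow k t z)) (at t within S)" if "z \<noteq> 0" for z t S
  proof -
    have nz: "vflow k t z \<noteq> 0" using that norm_vflow[of k t z] by force
    have "(?F \<circ> (\<lambda>t. vflow k t z) has_vector_derivative
        frechet_derivative ?F (at (vflow k t z)) (vfield k (vflow k t z))) (at t within S)"
      by (rule vector_derivative_diff_chain_within[OF vflow_has_vector_derivative])
        (use radial_ext_differentiable[OF assms nz] in
          \<open>auto simp: frechet_derivative_works intro: has_derivative_at_withinI\<close>)
    then show ?thesis by (simp add: radial_ext_vderiv[OF assms nz] comp_def)
  qed
  have bound: "norm (d n z) \<le> M" if "z \<noteq> 0" for n z
  proof -
    \<comment> \<open>Mean value inequality along the orbit over [0, h n]. The orbit of a nonzero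
      point avoids the origin, so M bounds the derivative on all of it.\<close>
    have "norm (?F (vflow k (h n) z) - ?F (vflow k 0 z)) \<le> M * norm (h n - 0)"
    proof (rule differentiable_bound[where S = "{0..h n}"])
      fix t assume "t \<in> {0..h n}"
      show "((\<lambda>t. ?F (vflow k t z)) has_derivative (\<lambda>x. x *\<^sub>R ?g (vflow k t z))) (at t within {0..h n})"
        using deriv[OF that] by (simp add: has_vector_derivative_def)
      have nz: "vflow k t z \<noteq> 0" using that norm_vflow[of k t z] by force
      then show "onorm (\<lambda>x. x *\<^sub>R ?g (vflow k t z)) \<le> M"
        using M[OF nz] by (intro onorm_le) (simp add: mult.commute[of M] mult_left_mono)
    qed (use h(1)[of n] in auto)
    moreover have "norm (d n z) = norm (?F (vflow k (h n) z) - ?F z) / h n"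
      using h(1)[of n] by (simp add: d_def divide_inverse mult.commute)
    ultimately show ?thesis using h(1)[of n] by (simp add: pos_divide_le_eq)
  qed
  have lim: "(\<lambda>n. d n z) \<longlonglongrightarrow> ?g z" if "z \<noteq> 0" for z
  proof -
    have "((\<lambda>t. (?F (vflow k t z) - ?F z) /\<^sub>R t) \<longlongrightarrow> ?g z) (at 0)"
    proof (rule LIM_zero_cancel, rule tendsto_norm_zero_cancel)
      have "((\<lambda>t. norm (?F (vflow k t z) - ?F z - t *\<^sub>R ?g z) / norm t) \<longlongrightarrow> 0) (at 0)"
        using deriv[OF that, of 0 UNIV] by (simp add: has_vector_derivative_def has_derivative_iff_norm)
      moreover have "norm ((?F (vflow k t z) - ?F z) /\<^sub>R t - ?g z) =
          norm (?F (vflow k t z) - ?F z - t *\<^sub>R ?g z) / norm t" if "t \<noteq> 0" for t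
      proof -
        have "(?F (vflow k t z) - ?F z) /\<^sub>R t - ?g z = (?F (vflow k t z) - ?F z - t *\<^sub>R ?g z) /\<^sub>R t"
          using that by (simp add: scaleR_diff_right)
        then show ?thesis by (simp add: divide_inverse mult.commute)
      qed
      ultimately show "((\<lambda>t. norm ((?F (vflow k t z) - ?F z) /\<^sub>R t - ?g z)) \<longlongrightarrow> 0) (at 0)"
        by (subst filterlim_cong[OF refl refl]) (auto simp: eventually_at_filter)
    qed
    moreover have "filterlim h (at 0) sequentially"
      using h0 h(1) by (auto simp: filterlim_at less_imp_neq[symmetric] intro!: always_eventually)
    ultimately show ?thesis unfolding d_def by (rule filterlim_compose)
  qed
  have FM [measurable]: "?F \<in> borel_measurable borel" "?g \<in> borel_measurable borel"
    using cont_S3_measurable F g by blast+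
  have vflow: "lborel_preserving (vflow k (h n))" for n
    using hcos by (rule lborel_preserving_vflow)
  have [measurable]: "vflow k (h n) \<in> borel_measurable borel" for n
    using vflow[of n] by (simp add: lborel_preserving_def)
  have int: "integrable lborel (\<lambda>z. indicator ?B z *\<^sub>R ?F z)"
    using cont_S3_integrable[OF F] by (simp add: set_integrable_def)
  \<comment> \<open>The flow preserves norms, hence the ball; so the indicator may be evaluated
    before or after the flow, and the change of variables stays within the ball.\<close>
  have ind: "indicat_real ?B z = indicator ?B (vflow k t z)" for t z
    by (simp add: indicator_def norm_vflow)
  have BF: "(\<lambda>z. indicat_real ?B z *\<^sub>R ?F z) \<in> borel_measurable borel"
    by (intro borel_measurable_scaleR borel_measurable_indicator FM) auto
  have int': "integrable lborel (\<lambda>z. indicator ?B z *\<^sub>R ?F (vflow k (h n) z))" for n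
  proof -
    have "integrable (distr lborel lborel (vflow k (h n))) (\<lambda>z. indicator ?B z *\<^sub>R ?F z)"
      using vflow[of n] int by (simp add: lborel_preserving_def)
    then show ?thesis
      using BF by (subst (asm) integrable_distr_eq) (auto simp: ind[symmetric])
  qed
  have ind_d: "(\<lambda>z. indicator ?B z *\<^sub>R d n z) =
      (\<lambda>z. (indicator ?B z *\<^sub>R ?F (vflow k (h n) z) - indicator ?B z *\<^sub>R ?F z) /\<^sub>R h n)" for n
    by (auto simp: d_def algebra_simps)
  have zero: "(\<integral>z. indicator ?B z *\<^sub>R d n z \<partial>lborel) = 0" for n
  proof -
    have "(\<integral>z. indicator ?B z *\<^sub>R ?F (vflow k (h n) z) \<partial>lborel) = (\<integral>z. indicator ?B z *\<^sub>R ?F z \<partial>lborel)"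
      using integral_lborel_preserving[OF vflow[of n] BF] by (simp add: ind[symmetric])
    then show ?thesis unfolding ind_d using int int' by simp
  qed
  have "(\<lambda>n. \<integral>z. indicator ?B z *\<^sub>R d n z \<partial>lborel) \<longlonglongrightarrow> (\<integral>z. indicator ?B z *\<^sub>R ?g z \<partial>lborel)"
  proof (rule integral_dominated_convergence[where w = "\<lambda>z. indicator ?B z *\<^sub>R M"])
    show "integrable lborel (\<lambda>z. indicator ?B z *\<^sub>R M)"
      by (rule integrableI_bounded_set_indicator[where B = M]) (use M0 emeasure_lborel_ball_finite[of "0 :: complex \<times> complex" 1] in auto)
    \<comment> \<open>The pointwise limit and the bound were obtained off the origin, which is a
      null set.\<close>
    show "AE z in lborel. (\<lambda>n. indicator ?B z *\<^sub>R d n z) \<longlonglongrightarrow> indicator ?B z *\<^sub>R ?g z"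
      using AE_lborel_singleton[of 0] by eventually_elim (use lim in \<open>auto intro!: tendsto_intros\<close>)
    show "AE z in lborel. norm (indicator ?B z *\<^sub>R d n z) \<le> indicator ?B z *\<^sub>R M" for n
      using AE_lborel_singleton[of 0] by eventually_elim (use bound in \<open>auto simp: indicator_def\<close>)
    show "(\<lambda>z. indicator ?B z *\<^sub>R ?g z) \<in> borel_measurable lborel"
      using borel_measurable_integrable[OF cont_S3_integrable[OF g, unfolded set_integrable_def]] .
    show "(\<lambda>z. indicator ?B z *\<^sub>R d n z) \<in> borel_measurable lborel" for n
      unfolding ind_d using int int' by (intro borel_measurable_integrable) auto
  qed
  then have "(\<lambda>n::nat. 0) \<longlonglongrightarrow> (\<integral>z. indicator ?B z *\<^sub>R ?g z \<partial>lborel)" by (simp add: zero)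
  then have "(\<integral>z. indicator ?B z *\<^sub>R ?g z \<partial>lborel) = 0" by (simp add: LIMSEQ_const_iff)
  then show ?thesis by (simp add: S3_integral_def set_lebesgue_integral_def)
qed


section \<open>The cocycles\<close>

lemma (in bounded_linear) cont_S3: "cont_S3 g \<Longrightarrow> cont_S3 (\<lambda>p. f (g p))"
  unfolding cont_S3_def by (rule continuous_on)

lemma (in bounded_bilinear) cont_S3: "cont_S3 f \<Longrightarrow> cont_S3 g \<Longrightarrow> cont_S3 (\<lambda>p. prod (f p) (g p))"
  unfolding cont_S3_def by (rule continuous_on)

interpretation qmul: bounded_bilinear qmul
  by (rule bounded_bilinear_qmul)

lemma qtr_add: "qtr (a + b) = qtr a + qtr b"
  and qtr_scaleR: "qtr (r *\<^sub>R a) = r *\<^sub>R qtr a"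
  and qtr_zero: "qtr 0 = 0"
  by (simp_all add: qtr_def algebra_simps)

lemmas qtr_cont_S3 = bounded_linear.cont_S3[OF bounded_linear_qtr]
  and qtr_smooth_S3 = bounded_linear.smooth_S3[OF bounded_linear_qtr]
  and qtr_vderiv = bounded_linear.vderiv[OF bounded_linear_qtr]

lemma qmul_assoc: "qmul (qmul a b) c = qmul a (qmul b c)"
  by (simp add: qmul_def algebra_simps)

lemma qtr_qmul_commute: "qtr (qmul a b) = qtr (qmul b a)"
  by (simp add: qtr_def qmul_def algebra_simps)

text \<open>\<open>qsigma\<close> is conjugation by the complex unit i, hence an algebra
  automorphism.\<close>

lemma qsigma_qmul: "qsigma (qmul a b) = qmul (qsigma a) (qsigma b)"
  by (simp add: qmul_def qsigma_def)

lemma qtr_qsigma: "qtr (qsigma a) = qtr a"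
  by (simp add: qtr_def qsigma_def)

text \<open>The factor 1/2 in \<open>Theta\<close> turns the constant 1 / (2 pi^2) into 1 / (4
  pi^2).\<close>

lemma cocycle_eq_vderiv:
  assumes "smooth_S3 \<phi>"
  shows "cocycle k \<phi> \<psi> = 1 / (4 * complex_of_real pi ^ 2) * S3_integral (\<lambda>p. qtr (qmul (vderiv k \<phi> p) (\<psi> p)))"
proof -
  have "(\<lambda>p. qtr (qmul (Theta k \<phi> p) (\<psi> p))) = (\<lambda>p. 1 / 2 * qtr (qmul (vderiv k \<phi> p) (\<psi> p)))"
    by (simp add: Theta_eq_vderiv[OF assms] qmul.scaleR_left qtr_scaleR scaleR_conv_of_real)
  then show ?thesis unfolding cocycle_def by (simp only: S3_integral_mult) simp
qed

lemma cont_S3_cocycle: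
  assumes "smooth_S3 \<phi>" "smooth_S3 \<psi>"
  shows "cont_S3 (\<lambda>p. qtr (qmul (vderiv k \<phi> p) (\<psi> p)))"
  by (intro qtr_cont_S3 qmul.cont_S3 cont_S3_vderiv cont_S3_smooth assms)

lemma cocycle_add_left:
  assumes "smooth_S3 \<phi>" "smooth_S3 \<phi>'" "smooth_S3 \<psi>"
  shows "cocycle k (\<lambda>p. \<phi> p + \<phi>' p) \<psi> = cocycle k \<phi> \<psi> + cocycle k \<phi>' \<psi>"
  using S3_integral_add[OF cont_S3_cocycle[OF assms(1,3), of k] cont_S3_cocycle[OF assms(2,3), of k]]
  by (simp add: cocycle_eq_vderiv smooth_S3_add assms vderiv_add qmul.add_left qtr_add add_divide_distrib)

lemma smooth_S3_scaleR: "smooth_S3 \<phi> \<Longrightarrow> smooth_S3 (\<lambda>p. r *\<^sub>R \<phi> p)"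
  by (rule bounded_linear.smooth_S3[OF bounded_linear_scaleR_right])

lemma cocycle_scaleR_left:
  assumes "smooth_S3 \<phi>"
  shows "cocycle k (\<lambda>p. r *\<^sub>R \<phi> p) \<psi> = of_real r * cocycle k \<phi> \<psi>"
  using S3_integral_mult[of "of_real r" "\<lambda>p. qtr (qmul (vderiv k \<phi> p) (\<psi> p))"]
  by (simp add: cocycle_eq_vderiv smooth_S3_scaleR assms bounded_linear.vderiv[OF bounded_linear_scaleR_right]
      qmul.scaleR_left qtr_scaleR scaleR_conv_of_real)

text \<open>By the Leibniz rule and the symmetry of the trace, the two integrands add up to the
  derivative of tr (\<phi> \<psi>), which integrates to 0.\<close>

lemma cocycle_antisym:
  assumes "smooth_S3 \<phi>" "smooth_S3 \<psi>"
  shows "cocycle k \<phi> \<psi> = - cocycle k \<psi> \<phi>"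
proof -
  have s: "smooth_S3 (\<lambda>p. qmul (\<phi> p) (\<psi> p))"
    by (intro qmul.smooth_S3 assms)
  have "S3_integral (\<lambda>p. qtr (qmul (vderiv k \<phi> p) (\<psi> p))) + S3_integral (\<lambda>p. qtr (qmul (vderiv k \<psi> p) (\<phi> p)))
      = S3_integral (\<lambda>p. qtr (qmul (vderiv k \<phi> p) (\<psi> p)) + qtr (qmul (vderiv k \<psi> p) (\<phi> p)))"
    by (intro S3_integral_add[symmetric] cont_S3_cocycle assms)
  also have "\<dots> = S3_integral (vderiv k (\<lambda>p. qtr (qmul (\<phi> p) (\<psi> p))))"
    by (rule arg_cong[where f = S3_integral])
      (auto simp: fun_eq_iff qtr_vderiv[OF s] qmul.vderiv[OF assms] qtr_add qtr_qmul_commute[of "\<phi> p" "vderiv k \<psi> p" for p])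
  also have "\<dots> = 0"
    by (intro S3_integral_vderiv qtr_smooth_S3 s)
  finally show ?thesis
    by (simp add: cocycle_eq_vderiv assms add_eq_0_iff)
qed

lemma cocycle_add_right:
  assumes "smooth_S3 \<phi>" "smooth_S3 \<psi>" "smooth_S3 \<psi>'"
  shows "cocycle k \<phi> (\<lambda>p. \<psi> p + \<psi>' p) = cocycle k \<phi> \<psi> + cocycle k \<phi> \<psi>'"
  using assms by (simp add: cocycle_antisym[of \<phi>] smooth_S3_add cocycle_add_left)

lemma cocycle_zero_left [simp]: "cocycle k (\<lambda>p. 0) \<psi> = 0"
  using cocycle_scaleR_left[OF smooth_S3_zero, of k 0 \<psi>] by simp

lemma cocycle_zero_right [simp]: "cocycle k \<phi> (\<lambda>p. 0) = 0"
  by (simp add: cocycle_def qmul.zero_right qtr_zero S3_integral_mult[of 0 "\<lambda>p. 0", simplified])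

lemma cocycle_sum_right:
  assumes "smooth_S3 \<phi>" "finite I" "\<And>i. i \<in> I \<Longrightarrow> smooth_S3 (\<psi> i)"
  shows "cocycle k \<phi> (\<lambda>p. \<Sum>i\<in>I. \<psi> i p) = (\<Sum>i\<in>I. cocycle k \<phi> (\<psi> i))"
  using assms(2,3) by (induction I) (simp_all add: assms(1) cocycle_add_right smooth_S3_sum)

text \<open>The same argument for the derivative of the triple trace tr (\<phi> \<psi>
  \<eta>).\<close>

lemma cocycle_cyclic:
  assumes "smooth_S3 \<phi>" "smooth_S3 \<psi>" "smooth_S3 \<eta>"
  shows "cocycle k \<phi> (\<lambda>p. qmul (\<psi> p) (\<eta> p)) + cocycle k \<psi> (\<lambda>p. qmul (\<eta> p) (\<phi> p))
    + cocycle k \<eta> (\<lambda>p. qmul (\<phi> p) (\<psi> p)) = 0"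
proof -
  note s = assms qmul.smooth_S3[OF assms(1,2)] qmul.smooth_S3[OF assms(2,3)] qmul.smooth_S3[OF assms(3,1)]
    qmul.smooth_S3[OF assms(1) qmul.smooth_S3[OF assms(2,3)]]
  let ?I = "\<lambda>\<phi> \<psi> \<eta>. S3_integral (\<lambda>p. qtr (qmul (vderiv k \<phi> p) (qmul (\<psi> p) (\<eta> p))))"
  \<comment> \<open>Cyclic invariance of the trace, used to match the three Leibniz terms with the
    three cocycle integrands.\<close>
  have rot: "qtr (qmul a (qmul b c)) = qtr (qmul b (qmul c a))" for a b c
    by (simp add: qmul_assoc[symmetric] qtr_qmul_commute[of a] flip: qmul_assoc)
      (simp add: qmul_assoc qtr_qmul_commute[of a])
  have add: "cont_S3 f \<Longrightarrow> cont_S3 g \<Longrightarrow> cont_S3 (\<lambda>p. f p + g p :: complex)" for f g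
    unfolding cont_S3_def by (rule continuous_on_add)
  have "?I \<phi> \<psi> \<eta> + ?I \<psi> \<eta> \<phi> + ?I \<eta> \<phi> \<psi> = S3_integral (\<lambda>p. qtr (qmul (vderiv k \<phi> p) (qmul (\<psi> p) (\<eta> p)))
      + qtr (qmul (vderiv k \<psi> p) (qmul (\<eta> p) (\<phi> p))) + qtr (qmul (vderiv k \<eta> p) (qmul (\<phi> p) (\<psi> p))))"
    by (subst S3_integral_add, intro add cont_S3_cocycle s, intro cont_S3_cocycle s,
        subst S3_integral_add, intro cont_S3_cocycle s, intro cont_S3_cocycle s) (rule refl)
  also have "\<dots> = S3_integral (vderiv k (\<lambda>p. qtr (qmul (\<phi> p) (qmul (\<psi> p) (\<eta> p)))))"
    by (rule arg_cong[where f = S3_integral])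
      (auto simp: fun_eq_iff qtr_vderiv s qmul.vderiv qtr_add qmul.add_right
        rot[of "\<phi> _" "vderiv k \<psi> _"] rot[of "vderiv k \<eta> _"])
  also have "\<dots> = 0"
    by (intro S3_integral_vderiv qtr_smooth_S3 s)
  finally show ?thesis
    by (simp add: cocycle_eq_vderiv assms flip: add_divide_distrib)
qed

text \<open>Being real linear, \<open>qsigma\<close> passes through the derivative; being
  multiplicative and trace-preserving, it then disappears from the integrand.\<close>

lemma cocycle_qsigma:
  assumes "smooth_S3 \<phi>"
  shows "cocycle k (\<lambda>p. qsigma (\<phi> p)) (\<lambda>p. qsigma (\<psi> p)) = cocycle k \<phi> \<psi>"
  using assms bounded_linear.smooth_S3[OF bounded_linear_qsigma assms]
  by (simp add: cocycle_eq_vderiv bounded_linear.vderiv[OF bounded_linear_qsigma]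
      qsigma_qmul[symmetric] qtr_qsigma)

section \<open>Matrix-valued maps: product and cocycle\<close>

definition qmat_mult :: "quat ^ 'n ^ 'm \<Rightarrow> quat ^ 'l ^ 'n \<Rightarrow> quat ^ 'l ^ 'm" where
  "qmat_mult A B = (\<chi> i j. \<Sum>l\<in>UNIV. qmul (A $ i $ l) (B $ l $ j))"

lemma qmat_mult_assoc: "qmat_mult (qmat_mult A B) C = qmat_mult A (qmat_mult B C)"
  by (simp add: vec_eq_iff qmat_mult_def qmul.sum_left qmul.sum_right qmul_assoc) (auto intro: sum.swap)

lemma bounded_bilinear_qmat_mult: "bounded_bilinear qmat_mult"
  by (rule bilinear_conv_bounded_bilinear[THEN iffD1])
    (auto simp: bilinear_def qmat_mult_def vec_eq_iff qmul.add_left qmul.add_right qmul.scaleR_left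
      qmul.scaleR_right sum.distrib scaleR_sum_right intro!: linearI)

interpretation qmat_mult: bounded_bilinear qmat_mult
  by (rule bounded_bilinear_qmat_mult)

text \<open>The extension of (X|Y) c_k(\<phi>, \<psi>) to sums of tensors with matrix units: the
  trace form pairs E_ij with E_ji only.\<close>

definition mat_cocycle :: "3 \<Rightarrow> (S3 \<Rightarrow> quat ^ 'n ^ 'n) \<Rightarrow> (S3 \<Rightarrow> quat ^ 'n ^ 'n) \<Rightarrow> complex" where
  "mat_cocycle k F G = (\<Sum>i\<in>UNIV. \<Sum>j\<in>UNIV. cocycle k (\<lambda>p. F p $ i $ j) (\<lambda>p. G p $ j $ i))"

lemma smooth_S3_mat_iff:
  fixes F :: "S3 \<Rightarrow> quat ^ 'n ^ 'm"
  shows "smooth_S3 F \<longleftrightarrow> (\<forall>i j. smooth_S3 (\<lambda>p. F p $ i $ j))"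
  unfolding smooth_S3_vec_iff ..

lemma mat_cocycle_add_left:
  assumes "smooth_S3 F" "smooth_S3 F'" "smooth_S3 G"
  shows "mat_cocycle k (\<lambda>p. F p + F' p) G = mat_cocycle k F G + mat_cocycle k F' G"
  using assms by (simp add: mat_cocycle_def smooth_S3_mat_iff cocycle_add_left sum.distrib)

lemma mat_cocycle_scaleR_left:
  assumes "smooth_S3 F"
  shows "mat_cocycle k (\<lambda>p. r *\<^sub>R F p) G = of_real r * mat_cocycle k F G"
  using assms by (simp add: mat_cocycle_def smooth_S3_mat_iff cocycle_scaleR_left sum_distrib_left)

lemma mat_cocycle_antisym:
  assumes "smooth_S3 F" "smooth_S3 G"
  shows "mat_cocycle k F G = - mat_cocycle k G F"
proof -
  have "mat_cocycle k F G = (\<Sum>i\<in>UNIV. \<Sum>j\<in>UNIV. - cocycle k (\<lambda>p. G p $ j $ i) (\<lambda>p. F p $ i $ j))"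
    unfolding mat_cocycle_def using assms
    by (intro sum.cong refl cocycle_antisym) (auto simp: smooth_S3_mat_iff)
  also have "\<dots> = - mat_cocycle k G F"
    unfolding mat_cocycle_def sum_negf by (subst sum.swap) (rule refl)
  finally show ?thesis .
qed

lemma mat_cocycle_add_right:
  assumes "smooth_S3 F" "smooth_S3 G" "smooth_S3 G'"
  shows "mat_cocycle k F (\<lambda>p. G p + G' p) = mat_cocycle k F G + mat_cocycle k F G'"
  using assms by (simp add: mat_cocycle_antisym[of F] smooth_S3_add mat_cocycle_add_left)

lemma mat_cocycle_scaleR_right:
  assumes "smooth_S3 F" "smooth_S3 G"
  shows "mat_cocycle k F (\<lambda>p. r *\<^sub>R G p) = of_real r * mat_cocycle k F G"
  using assms by (simp add: mat_cocycle_antisym[of F] smooth_S3_scaleR mat_cocycle_scaleR_left)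

lemma mat_cocycle_diff_right:
  assumes "smooth_S3 F" "smooth_S3 G" "smooth_S3 G'"
  shows "mat_cocycle k F (\<lambda>p. G p - G' p) = mat_cocycle k F G - mat_cocycle k F G'"
  using mat_cocycle_add_right[OF assms(1,2) smooth_S3_scaleR[OF assms(3)], of k "-1"]
    mat_cocycle_scaleR_right[OF assms(1,3), of k "-1"] by simp

lemma mat_cocycle_mult:
  assumes "smooth_S3 F" "smooth_S3 G" "smooth_S3 H"
  shows "mat_cocycle k F (\<lambda>p. qmat_mult (G p) (H p)) = (\<Sum>i\<in>UNIV. \<Sum>j\<in>UNIV. \<Sum>l\<in>UNIV.
    cocycle k (\<lambda>p. F p $ i $ j) (\<lambda>p. qmul (G p $ j $ l) (H p $ l $ i)))"
  using assms
  by (simp add: mat_cocycle_def qmat_mult_def cocycle_sum_right smooth_S3_mat_iff qmul.smooth_S3)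

text \<open>The cocycle condition of the commutator bracket is the difference of two instances of this
  identity.\<close>

lemma mat_cocycle_cyclic:
  assumes "smooth_S3 F" "smooth_S3 G" "smooth_S3 H"
  shows "mat_cocycle k F (\<lambda>p. qmat_mult (G p) (H p)) + mat_cocycle k G (\<lambda>p. qmat_mult (H p) (F p))
    + mat_cocycle k H (\<lambda>p. qmat_mult (F p) (G p)) = 0"
proof -
  let ?t = "\<lambda>F G H i j l. cocycle k (\<lambda>p. F p $ i $ j) (\<lambda>p. qmul (G p $ j $ l) (H p $ l $ i))"
  \<comment> \<open>The summation indices are renamed cyclically so that all three triple sums run
    over the same entries F_ij, G_jl, H_li and can be added term by term.\<close>
  have 1: "mat_cocycle k G (\<lambda>p. qmat_mult (H p) (F p)) = (\<Sum>i\<in>UNIV. \<Sum>j\<in>UNIV. \<Sum>l\<in>UNIV. ?t G H F j l i)"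
    unfolding mat_cocycle_mult[OF assms(2,3,1)]
    by (subst (2) sum.swap) (subst sum.swap, rule refl)
  have 2: "mat_cocycle k H (\<lambda>p. qmat_mult (F p) (G p)) = (\<Sum>i\<in>UNIV. \<Sum>j\<in>UNIV. \<Sum>l\<in>UNIV. ?t H F G l i j)"
    unfolding mat_cocycle_mult[OF assms(3,1,2)]
    by (subst sum.swap) (subst (2) sum.swap, rule refl)
  have "?t F G H i j l + ?t G H F j l i + ?t H F G l i j = 0" for i j l
    using assms by (intro cocycle_cyclic) (auto simp: smooth_S3_mat_iff)
  then show ?thesis
    unfolding 1 2 mat_cocycle_mult[OF assms] by (simp flip: sum.distrib)
qed

lemma mat_cocycle_qsigma:
  assumes "smooth_S3 F"
  shows "mat_cocycle k (\<lambda>p. \<chi> i j. qsigma (F p $ i $ j)) (\<lambda>p. \<chi> i j. qsigma (G p $ i $ j)) = mat_cocycle k F G"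
  using assms by (simp add: mat_cocycle_def cocycle_qsigma smooth_S3_mat_iff)


section \<open>The bracket\<close>

lemma quaternion_module_ambient:
  "quaternion_module (amb_scale :: complex \<Rightarrow> 'n::finite ambient \<Rightarrow> _) amb_J amb_V0"
proof -
  interpret vector_space "amb_scale :: complex \<Rightarrow> 'n ambient \<Rightarrow> _"
    by unfold_locales
      (simp_all add: amb_scale_def qscale_def prod_eq_iff fun_eq_iff vec_eq_iff algebra_simps)
  show ?thesis
  proof unfold_locales
    fix x y v :: "'n ambient" and c :: complex
    show "amb_J (x + y) = amb_J x + amb_J y"
      by (simp add: amb_J_def qJ_def prod_eq_iff fun_eq_iff vec_eq_iff)
    show "amb_J (amb_scale c x) = amb_scale (cnj c) (amb_J x)"
      by (simp add: amb_J_def amb_scale_def qscale_def qJ_def prod_eq_iff fun_eq_iff vec_eq_iff)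
    show "amb_J (amb_J x) = - x"
      by (simp add: amb_J_def qJ_def prod_eq_iff fun_eq_iff vec_eq_iff)
    show "subspace (amb_V0 :: 'n ambient set)"
      by (auto simp: subspace_def amb_V0_def amb_scale_def qscale_def)
    show "\<exists>x\<in>amb_V0. \<exists>y\<in>amb_V0. v = x + amb_J y"
    proof (intro bexI)
      \<comment> \<open>Since J sends the complex number y to j conj(y), the part j v of a
        quaternion arises from y = conj(v).\<close>
      let ?x = "((\<lambda>p. \<chi> i j. (fst (fst v p $ i $ j), 0)), (\<chi> k. (fst (snd v $ k), 0))) :: 'n ambient"
      let ?y = "((\<lambda>p. \<chi> i j. (cnj (snd (fst v p $ i $ j)), 0)), (\<chi> k. (cnj (snd (snd v $ k)), 0))) :: 'n ambient"
      show "v = ?x + amb_J ?y"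
        by (simp add: amb_J_def qJ_def prod_eq_iff fun_eq_iff vec_eq_iff)
      show "?x \<in> amb_V0" "?y \<in> amb_V0" by (auto simp: amb_V0_def)
    qed
    \<comment> \<open>Elements of \<open>amb_V0\<close> have no j-component, while their images
      under J have nothing else.\<close>
    have "x = 0" if "x \<in> amb_V0" "x = amb_J y" "y \<in> amb_V0" for x y :: "'n ambient"
      using that by (auto simp: amb_V0_def amb_J_def qJ_def prod_eq_iff fun_eq_iff vec_eq_iff)
    moreover have "(0 :: 'n ambient) \<in> amb_V0" "amb_J (0 :: 'n ambient) = 0"
      by (auto simp: amb_V0_def amb_J_def qJ_def prod_eq_iff fun_eq_iff vec_eq_iff)
    ultimately show "amb_V0 \<inter> amb_J ` amb_V0 = {0 :: 'n ambient}"
      by (auto simp: image_iff)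
  qed
qed

interpretation amb: quaternion_module amb_scale amb_J amb_V0
  by (rule quaternion_module_ambient)

definition amb_sigma :: "'n::finite ambient \<Rightarrow> 'n ambient" where
  "amb_sigma x = ((\<lambda>p. \<chi> i j. qsigma (fst x p $ i $ j)), (\<chi> k. qsigma (snd x $ k)))"

text \<open>Changing the sign of the j-components turns x + J y into x - J y for every admissible
  decomposition, so the definite description has exactly this value.\<close>

lemma involution_ambient: "amb.involution (v :: 'n::finite ambient) = amb_sigma v"
proof -
  have sigma: "x - amb_J y = amb_sigma (x + amb_J y)" if "x \<in> amb_V0" "y \<in> amb_V0" for x y :: "'n ambient"
    using that by (simp add: amb_V0_def amb_sigma_def qsigma_def amb_J_def qJ_def prod_eq_iff fun_eq_iff vec_eq_iff)
  show ?thesis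
    unfolding amb.involution_def
  proof (rule the_equality)
    show "\<exists>x\<in>amb_V0. \<exists>y\<in>amb_V0. v = x + amb_J y \<and> amb_sigma v = x - amb_J y"
      using amb.V0_sum[of v] sigma by metis
    show "w = amb_sigma v" if "\<exists>x\<in>amb_V0. \<exists>y\<in>amb_V0. v = x + amb_J y \<and> w = x - amb_J y" for w
      using that sigma by blast
  qed
qed

text \<open>An explicit candidate that involves no basis. The second components of the arguments do
  not enter, which is what makes the a_k central.\<close>

definition S3gl_bracket :: "'n::finite ambient \<Rightarrow> 'n ambient \<Rightarrow> 'n ambient" where
  "S3gl_bracket x y = ((\<lambda>p. qmat_mult (fst x p) (fst y p) - qmat_mult (fst y p) (fst x p)),
     (\<chi> k. (mat_cocycle k (fst x) (fst y), 0)))"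

section \<open>Closure and Lie algebra identities of the explicit bracket\<close>

lemma fst_amb_add: "fst (x + y) = (\<lambda>p. fst x p + fst y p)"
  for x y :: "'n::finite ambient"
  by (simp add: fun_eq_iff)

lemma fst_amb_scale_of_real: "fst (amb_scale (of_real r) x) = (\<lambda>p. r *\<^sub>R fst x p)"
  by (simp add: amb_scale_def qscale_def prod_eq_iff vec_eq_iff fun_eq_iff scaleR_conv_of_real mult.commute)

lemma snd_amb_scale: "snd (amb_scale c x) = (\<chi> k. qscale c (snd x $ k))"
  by (simp add: amb_scale_def)

lemma S3gl_a_smooth: "x \<in> S3gl_a \<Longrightarrow> smooth_S3 (fst x)"
  by (simp add: S3gl_a_def)

lemma smooth_S3_map:
  fixes F :: "S3 \<Rightarrow> quat ^ 'n ^ 'm" and f :: "quat \<Rightarrow> quat"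
  assumes "smooth_S3 F" "bounded_linear f"
  shows "smooth_S3 (\<lambda>p. \<chi> i j. f (F p $ i $ j))"
  using assms(1) by (auto simp: smooth_S3_mat_iff intro: bounded_linear.smooth_S3[OF assms(2)])

lemma S3gl_a_zero: "0 \<in> S3gl_a"
  using smooth_S3_zero by (simp add: S3gl_a_def zero_fun_def)

lemma S3gl_a_add: "x \<in> S3gl_a \<Longrightarrow> y \<in> S3gl_a \<Longrightarrow> x + y \<in> S3gl_a"
  unfolding S3gl_a_def by (simp add: fst_amb_add smooth_S3_add del: fst_add)

lemma S3gl_a_scale: "x \<in> S3gl_a \<Longrightarrow> amb_scale c x \<in> S3gl_a"
  using smooth_S3_map[OF _ bounded_linear_qscale, of "fst x" c]
  by (simp add: S3gl_a_def amb_scale_def qscale_def[of c "snd x $ _"])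

lemma S3gl_a_sigma: "x \<in> S3gl_a \<Longrightarrow> amb_sigma x \<in> S3gl_a"
  using smooth_S3_map[OF _ bounded_linear_qsigma, of "fst x"]
  by (simp add: S3gl_a_def amb_sigma_def qsigma_def[of "snd x $ _"])

lemma subspace_S3gl_a: "amb.subspace S3gl_a"
  unfolding amb.subspace_def using S3gl_a_zero S3gl_a_add S3gl_a_scale by blast

lemma S3gl_bracket_in_S3gl_a:
  "x \<in> S3gl_a \<Longrightarrow> y \<in> S3gl_a \<Longrightarrow> S3gl_bracket x y \<in> S3gl_a"
  by (simp add: S3gl_a_def S3gl_bracket_def smooth_S3_diff qmat_mult.smooth_S3)

lemma S3gl_bracket_bilinear: "real_bilinear_on amb_scale S3gl_a (S3gl_bracket :: 'n::finite ambient \<Rightarrow> _)"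
  unfolding real_bilinear_on_def
proof (intro conjI ballI allI)
  fix x y z :: "'n ambient" and r :: real
  assume "x \<in> S3gl_a" "y \<in> S3gl_a"
  note s = this[THEN S3gl_a_smooth]
  \<comment> \<open>The type instance of \<open>prod_eq_iff\<close> splits only the outer pair; a
    quaternion is itself a pair and has to stay whole.\<close>
  show "S3gl_bracket (amb_scale (complex_of_real r) x) y = amb_scale (complex_of_real r) (S3gl_bracket x y)"
    "S3gl_bracket x (amb_scale (complex_of_real r) y) = amb_scale (complex_of_real r) (S3gl_bracket x y)"
    using s by (simp_all add: prod_eq_iff[where 'a = "S3 \<Rightarrow> quat ^ 'n ^ 'n" and 'b = "quat ^ 3"] fst_amb_scale_of_real)
      (simp_all add: S3gl_bracket_def fst_amb_scale_of_real mat_cocycle_scaleR_left mat_cocycle_scaleR_right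
        qmat_mult.scaleR_left qmat_mult.scaleR_right scaleR_diff_right snd_amb_scale qscale_def mult.commute)
  assume "z \<in> S3gl_a"
  note s = s S3gl_a_smooth[OF this]
  show "S3gl_bracket (x + y) z = S3gl_bracket x z + S3gl_bracket y z"
    "S3gl_bracket z (x + y) = S3gl_bracket z x + S3gl_bracket z y"
    using s by (simp_all add: S3gl_bracket_def fst_amb_add mat_cocycle_add_left mat_cocycle_add_right
        qmat_mult.add_left qmat_mult.add_right vec_eq_iff fun_eq_iff del: fst_add)
qed

lemma S3gl_bracket_antisym:
  assumes "x \<in> S3gl_a" "y \<in> S3gl_a"
  shows "S3gl_bracket x y = - S3gl_bracket y x"
  using mat_cocycle_antisym[OF assms[THEN S3gl_a_smooth]]
  by (simp add: S3gl_bracket_def prod_eq_iff fun_eq_iff vec_eq_iff)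

text \<open>The matrix part is the Jacobi identity of a commutator in an associative algebra. In the
  central part only the commutators of the inner brackets matter, and the cyclic identities for (x,
  y, z) and (x, z, y) are subtracted.\<close>

lemma S3gl_bracket_Jacobi:
  fixes x y z :: "'n::finite ambient"
  assumes "x \<in> S3gl_a" "y \<in> S3gl_a" "z \<in> S3gl_a"
  shows "S3gl_bracket x (S3gl_bracket y z) + S3gl_bracket y (S3gl_bracket z x)
    + S3gl_bracket z (S3gl_bracket x y) = 0"
proof -
  note s = assms[THEN S3gl_a_smooth]
  let ?c = "\<lambda>k F G H. mat_cocycle k F (\<lambda>p. qmat_mult (G p) (H p) - qmat_mult (H p) (G p))"
  have "?c k (fst x) (fst y) (fst z) + ?c k (fst y) (fst z) (fst x) + ?c k (fst z) (fst x) (fst y) = 0" for k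
  proof -
    let ?m = "\<lambda>F G H. mat_cocycle k F (\<lambda>p. qmat_mult (G p) (H p))"
    have "?c k (fst x) (fst y) (fst z) + ?c k (fst y) (fst z) (fst x) + ?c k (fst z) (fst x) (fst y) =
        (?m (fst x) (fst y) (fst z) + ?m (fst y) (fst z) (fst x) + ?m (fst z) (fst x) (fst y)) -
        (?m (fst x) (fst z) (fst y) + ?m (fst z) (fst y) (fst x) + ?m (fst y) (fst x) (fst z))"
      using s by (simp add: mat_cocycle_diff_right qmat_mult.smooth_S3)
    also have "\<dots> = 0"
      using mat_cocycle_cyclic[OF s, of k] mat_cocycle_cyclic[OF s(1,3,2), of k] by simp
    finally show ?thesis .
  qed
  then show ?thesis
    by (simp add: S3gl_bracket_def prod_eq_iff[where 'a = "S3 \<Rightarrow> quat ^ 'n ^ 'n" and 'b = "quat ^ 3"] fun_eq_iff)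
      (simp add: vec_eq_iff prod_eq_iff qmat_mult.diff_left qmat_mult.diff_right qmat_mult_assoc)
qed

lemma qmat_mult_qsigma:
  "qmat_mult (\<chi> i j. qsigma (A $ i $ j)) (\<chi> i j. qsigma (B $ i $ j)) = (\<chi> i j. qsigma (qmat_mult A B $ i $ j))"
  by (simp add: qmat_mult_def vec_eq_iff qsigma_qmul
      linear_sum[OF bounded_linear.linear[OF bounded_linear_qsigma]])

text \<open>Entrywise \<open>qsigma\<close> respects the matrix product and the cocycle, and it
  fixes the central coefficients, which have no j-component.\<close>

lemma S3gl_bracket_sigma:
  assumes "x \<in> S3gl_a"
  shows "amb_sigma (S3gl_bracket x y) = S3gl_bracket (amb_sigma x) (amb_sigma y)"
  using mat_cocycle_qsigma[OF S3gl_a_smooth[OF assms]]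
  by (simp add: amb_sigma_def S3gl_bracket_def qmat_mult_qsigma)
    (simp add: qsigma_def vec_eq_iff fun_eq_iff prod_eq_iff)

section \<open>Values on tensors with matrix units\<close>

lemma gl_basis_entry:
  assumes "X \<in> gl_basis"
  shows "X $ i $ j = 0 \<or> X $ i $ j = 1"
  using assms by (auto simp: gl_basis_def)

text \<open>The entries 0 and 1 can be pulled out of \<open>cocycle\<close>. General complex scalars
  cannot, because the cocycle is only real bilinear; the formula is therefore tied to basis
  matrices.\<close>

lemma mat_cocycle_tens:
  assumes "X \<in> gl_basis" "Y \<in> gl_basis"
  shows "mat_cocycle k (fst (tens \<phi> X)) (fst (tens \<psi> Y)) = trace (X ** Y) * cocycle k \<phi> \<psi>"
proof -
  have "cocycle k (\<lambda>p. qscale (X $ i $ j) (\<phi> p)) (\<lambda>p. qscale (Y $ j $ i) (\<psi> p)) =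
      X $ i $ j * Y $ j $ i * cocycle k \<phi> \<psi>" for i j
    using gl_basis_entry[OF assms(1), of i j] gl_basis_entry[OF assms(2), of j i]
    by (auto simp: qscale_def zero_prod_def[symmetric])
  then show ?thesis
    by (simp add: mat_cocycle_def tens_def trace_def matrix_matrix_mult_def sum_distrib_right)
qed

lemma qmat_mult_tens:
  assumes "X \<in> gl_basis" "Y \<in> gl_basis"
  shows "qmat_mult (fst (tens \<phi> X) p) (fst (tens \<psi> Y) p) = fst (tens (\<lambda>p. qmul (\<phi> p) (\<psi> p)) (X ** Y)) p"
proof -
  have "qmul (qscale (X $ i $ l) a) (qscale (Y $ l $ j) b) = qscale (X $ i $ l * Y $ l $ j) (qmul a b)" for i j l a b
    using gl_basis_entry[OF assms(1), of i l] gl_basis_entry[OF assms(2), of l j]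
    by (auto simp: qscale_def qmul_def)
  moreover have "qscale (\<Sum>l\<in>UNIV. f l) a = (\<Sum>l\<in>UNIV. qscale (f l) a)" for f :: "'a \<Rightarrow> complex" and a
    by (simp add: qscale_def prod_eq_iff fst_sum snd_sum sum_distrib_left)
  ultimately show ?thesis
    by (simp add: qmat_mult_def tens_def matrix_matrix_mult_def)
qed

lemma sum_fun_apply: "(\<Sum>i\<in>I. f i) x = (\<Sum>i\<in>I. f i x)"
  for f :: "'i \<Rightarrow> 'b \<Rightarrow> 'c::comm_monoid_add"
  by (induction I rule: infinite_finite_induct) simp_all

lemma sum_central:
  "(\<Sum>k\<in>UNIV. amb_scale (c k) (central k)) = ((\<lambda>p. 0), \<chi> k. (c k, 0))"
  by (rule prod_eqI)
    (auto simp: fst_sum snd_sum fun_eq_iff vec_eq_iff sum_fun_apply amb_scale_def central_def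
      axis_def qscale_def if_distrib prod_eq_iff cong: if_cong)

lemma is_S3gl_bracket_S3gl_bracket: "is_S3gl_bracket (S3gl_bracket :: 'n::finite ambient \<Rightarrow> _)"
  unfolding is_S3gl_bracket_def
proof (intro conjI ballI allI S3gl_bracket_bilinear)
  show "S3gl_bracket (tens \<phi> X) (tens \<psi> Y) =
          tens (\<lambda>p. qmul (\<phi> p) (\<psi> p)) (X ** Y) - tens (\<lambda>p. qmul (\<psi> p) (\<phi> p)) (Y ** X)
          + amb_scale (trace (X ** Y)) (\<Sum>k\<in>UNIV. amb_scale (cocycle k \<phi> \<psi>) (central k))"
    if "X \<in> gl_basis" "Y \<in> gl_basis" for \<phi> \<psi> and X Y :: "complex ^ 'n ^ 'n"
    using that unfolding S3gl_bracket_def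
    by (simp add: mat_cocycle_tens qmat_mult_tens prod_eq_iff[where 'a = "S3 \<Rightarrow> quat ^ 'n ^ 'n" and 'b = "quat ^ 3"] fun_eq_iff sum_central)
      (simp add: tens_def vec_eq_iff amb_scale_def qscale_def prod_eq_iff)
  show "S3gl_bracket (amb_scale c (central k)) x = 0" "S3gl_bracket x (amb_scale c (central k)) = 0"
    for k c and x :: "'n ambient"
    by (simp_all add: S3gl_bracket_def central_def amb_scale_def qscale_def mat_cocycle_def
       zero_prod_def[symmetric] zero_vec_def[symmetric] qmat_mult.zero_left qmat_mult.zero_right
       prod_eq_iff fun_eq_iff vec_eq_iff)
qed

section \<open>Additive generators and uniqueness of the bracket\<close>

lemma S3gl_a_induct [consumes 1, case_names zero add tens central]:
  fixes x :: "'n::finite ambient"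
  assumes x: "x \<in> S3gl_a"
    and zero: "P 0"
    and add: "\<And>x y. x \<in> S3gl_a \<Longrightarrow> y \<in> S3gl_a \<Longrightarrow> P x \<Longrightarrow> P y \<Longrightarrow> P (x + y)"
    and tens: "\<And>\<phi> X. \<phi> \<in> S3H \<Longrightarrow> X \<in> gl_basis \<Longrightarrow> P (tens \<phi> X)"
    and central: "\<And>c k. P (amb_scale c (central k))"
  shows "P x"
proof -
  have sum: "(\<Sum>i\<in>I. f i) \<in> S3gl_a \<and> P (\<Sum>i\<in>I. f i)"
    if "\<And>i. f i \<in> S3gl_a \<and> P (f i)" for I :: "'i::finite set" and f
    using finite[of I] by (induction I) (auto simp: zero S3gl_a_zero that intro: add S3gl_a_add)
  define E where "E a b = ((\<chi> i j. if i = a \<and> j = b then 1 else 0) :: complex ^ 'n ^ 'n)" for a b :: 'n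
  have E: "E a b \<in> gl_basis" for a b by (auto simp: E_def gl_basis_def)
  have smooth: "smooth_S3 (\<lambda>p. fst x p $ a $ b)" for a b
    using S3gl_a_smooth[OF x] by (simp add: smooth_S3_mat_iff)
  have tens_in: "tens (\<lambda>p. fst x p $ a $ b) (E a b) \<in> S3gl_a" for a b
    using bounded_linear.smooth_S3[OF bounded_linear_qscale smooth]
    by (simp add: S3gl_a_def tens_def smooth_S3_mat_iff)
  have central_in: "amb_scale c (central k) \<in> S3gl_a" for c k
    using smooth_S3_zero by (intro S3gl_a_scale) (simp add: S3gl_a_def central_def zero_fun_def axis_def)
  \<comment> \<open>Each entry function is tensored with its matrix unit, so scalars are absorbed
    into the functions and additivity suffices for the induction. The rest of x is a complex
    combination of the a_k.\<close>
  let ?T = "\<Sum>a\<in>UNIV. \<Sum>b\<in>UNIV. tens (\<lambda>p. fst x p $ a $ b) (E a b)"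
  let ?C = "\<Sum>k\<in>UNIV. amb_scale (fst (snd x $ k)) (central k) :: 'n ambient"
  have T: "?T = (fst x, 0)"
  proof (rule prod_eqI)
    have "qscale (E a b $ i $ j) q = (if b = j then if a = i then q else 0 else 0)" for a b i j q
      by (auto simp: E_def qscale_def zero_prod_def)
    then show "fst ?T = fst (fst x, 0 :: quat ^ 3)"
      by (simp add: fst_sum fun_eq_iff vec_eq_iff sum_fun_apply tens_def)
    show "snd ?T = snd (fst x, 0 :: quat ^ 3)"
      by (simp add: snd_sum tens_def)
  qed
  have C: "?C = (0, snd x)"
    using x unfolding sum_central by (simp add: S3gl_a_def zero_fun_def vec_eq_iff prod_eq_iff)
  have "?T \<in> S3gl_a \<and> P ?T"
    using smooth by (intro sum conjI tens_in tens E) (simp add: S3H_def)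
  moreover have "?C \<in> S3gl_a \<and> P ?C"
    by (intro sum conjI central_in central)
  ultimately have "P (?T + ?C)" by (blast intro: add)
  then show ?thesis by (simp add: T C)
qed

text \<open>Both brackets are additive in each argument and take the same prescribed values on
  generators; induction on x, and inside it on y, spreads the agreement to
  \<open>S3gl_a\<close>.\<close>

lemma S3gl_bracket_unique:
  fixes x y :: "'n::finite ambient"
  assumes b: "is_S3gl_bracket br" "is_S3gl_bracket br'" and "x \<in> S3gl_a" "y \<in> S3gl_a"
  shows "br x y = br' x y"
proof -
  have L: "b (u + v) w = b u w + b v w" "b w (u + v) = b w u + b w v"
    if "is_S3gl_bracket b" "u \<in> S3gl_a" "v \<in> S3gl_a" "w \<in> S3gl_a" for b and u v w :: "'n ambient"
    using that unfolding is_S3gl_bracket_def real_bilinear_on_def by blast+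
  have Z: "b 0 w = 0" "b w 0 = 0" if "is_S3gl_bracket b" "w \<in> S3gl_a" for b and w :: "'n ambient"
    using L[OF that(1) S3gl_a_zero S3gl_a_zero that(2)] by simp_all
  have C: "b (amb_scale c (central k)) w = 0" "b w (amb_scale c (central k)) = 0"
    if "is_S3gl_bracket b" "w \<in> S3gl_a" for b c k and w :: "'n ambient"
    using that unfolding is_S3gl_bracket_def by blast+
  have V: "b (tens \<phi> X) (tens \<psi> Y) =
      tens (\<lambda>p. qmul (\<phi> p) (\<psi> p)) (X ** Y) - tens (\<lambda>p. qmul (\<psi> p) (\<phi> p)) (Y ** X)
      + amb_scale (trace (X ** Y)) (\<Sum>k\<in>UNIV. amb_scale (cocycle k \<phi> \<psi>) (central k))"
    if "is_S3gl_bracket b" "\<phi> \<in> S3H" "\<psi> \<in> S3H" "X \<in> gl_basis" "Y \<in> gl_basis"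
    for b \<phi> \<psi> and X Y :: "complex ^ 'n ^ 'n"
    using that unfolding is_S3gl_bracket_def by blast
  have tens_in: "tens \<phi> X \<in> S3gl_a" if "\<phi> \<in> S3H" for \<phi> and X :: "complex ^ 'n ^ 'n"
    using that bounded_linear.smooth_S3[OF bounded_linear_qscale]
    by (simp add: S3gl_a_def S3H_def tens_def smooth_S3_mat_iff)
  from assms(3) show ?thesis
  proof (induction rule: S3gl_a_induct)
    case (tens \<phi> X)
    from assms(4) show ?case
      by (induction rule: S3gl_a_induct) (use tens in \<open>simp_all add: L Z C V b tens_in\<close>)
  qed (simp_all add: L Z C b assms(4))
qed

text \<open>By uniqueness the properties of the explicit bracket transfer to \<open>br\<close> on
  \<open>S3gl_a\<close>. Closure is needed for the nested brackets of the Jacobi identity, since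
  agreement is known on \<open>S3gl_a\<close> only.\<close>

lemma quaternion_Lie_algebra_bracket:
  assumes "is_S3gl_bracket (br :: 'n::finite ambient \<Rightarrow> 'n ambient \<Rightarrow> 'n ambient)"
  shows "quaternion_Lie_algebra amb_scale amb_J amb_V0 S3gl_a br"
proof -
  have br: "br x y = S3gl_bracket x y" if "x \<in> S3gl_a" "y \<in> S3gl_a" for x y
    using S3gl_bracket_unique[OF assms is_S3gl_bracket_S3gl_bracket that] .
  show ?thesis
  proof (unfold_locales)
    show "amb.semi_submodule S3gl_a"
      by (simp add: amb.semi_submodule_def subspace_S3gl_a involution_ambient S3gl_a_sigma)
    show "real_bilinear_on amb_scale S3gl_a br"
      using assms by (simp add: is_S3gl_bracket_def)
    fix x y z :: "'n ambient"
    assume xy: "x \<in> S3gl_a" "y \<in> S3gl_a"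
    then show "br x y \<in> S3gl_a" by (simp add: br S3gl_bracket_in_S3gl_a)
    show "br x y = - br y x" using S3gl_bracket_antisym[OF xy] by (simp add: br xy)
    show "amb.involution (br x y) = br (amb.involution x) (amb.involution y)"
      using S3gl_bracket_sigma[OF xy(1)] by (simp add: involution_ambient br xy S3gl_a_sigma)
    assume "z \<in> S3gl_a"
    with S3gl_bracket_Jacobi[OF xy this] show "br x (br y z) + br y (br z x) + br z (br x y) = 0"
      by (simp add: br xy S3gl_bracket_in_S3gl_a)
  qed
qed

text \<open>The existence clause keeps the universal clause from being vacuous; the last two clauses
  match the abstract involution of the module with the prescribed \<sigma>.\<close>

theorem theorem3p1:
  shows "(\<exists>br :: 'n::finite ambient \<Rightarrow> 'n ambient \<Rightarrow> 'n ambient. is_S3gl_bracket br) \<and>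
    (\<forall>br :: 'n ambient \<Rightarrow> 'n ambient \<Rightarrow> 'n ambient. is_S3gl_bracket br \<longrightarrow>
       quaternion_Lie_algebra amb_scale amb_J amb_V0 S3gl_a br) \<and>
    (\<forall>\<phi>\<in>S3H. \<forall>X :: complex ^ 'n ^ 'n.
       quaternion_module.involution amb_J amb_V0 (tens \<phi> X) = tens (\<lambda>p. qsigma (\<phi> p)) X) \<and>
    (\<forall>k. quaternion_module.involution amb_J amb_V0 (central k :: 'n ambient) = central k)"
proof (intro conjI ballI allI impI)
  show "\<exists>br :: 'n ambient \<Rightarrow> 'n ambient \<Rightarrow> 'n ambient. is_S3gl_bracket br"
    using is_S3gl_bracket_S3gl_bracket by blast
  show "quaternion_Lie_algebra amb_scale amb_J amb_V0 S3gl_a br" if "is_S3gl_bracket br"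
    for br :: "'n ambient \<Rightarrow> 'n ambient \<Rightarrow> 'n ambient"
    using that by (rule quaternion_Lie_algebra_bracket)
  show "amb.involution (tens \<phi> X) = tens (\<lambda>p. qsigma (\<phi> p)) X" for \<phi> and X :: "complex ^ 'n ^ 'n"
    by (simp add: involution_ambient amb_sigma_def tens_def qsigma_def qscale_def vec_eq_iff fun_eq_iff prod_eq_iff)
  show "amb.involution (central k :: 'n ambient) = central k" for k
    by (simp add: involution_ambient amb_sigma_def central_def qsigma_def vec_eq_iff fun_eq_iff prod_eq_iff axis_def)
qed

end
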